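(* Let $G_2=\mathrm{Aut}(\mathbb{O})$ and $$M_7:=\{(w,W):\ W\in M_1',\ w\in W,\ n(w)=1\}.$$ The group $G_2$ acts transitively on $M_7$ by $f\cdot(w,W)=(f(w),f(W))$. The isotropy subgroup of $(\mathbf{l},\mathbb{H}\mathbf{l})\in M_7$ is $$H_7=\{f\in\mathrm{Aut}(\mathbb{O}):\ f(\mathbb{H})\subset\mathbb{H},\ f(\mathbf{l})=\mathbf{l}\},$$ and the restriction $f\mapsto f|_{\mathbb{H}_0\mathbf{l}}$ is an isomorphism $H_7\to\mathrm{SO}(\mathbb{H}_0\mathbf{l},n)\cong\mathrm{SO}(3)$. Hence $M_7$ is diffeomorphic to $G_2/\mathrm{SO}(3)$.
   Context: $\mathbb{O}=\mathbb{H}\oplus\mathbb{H}\mathbf{l}$ is the real octonion division algebra, where $\mathbb{H}=\langle 1,\mathbf{i},\mathbf{j},\mathbf{k}\rangle$ is the usual quaternion algebra, $\mathbb{H}_0=\langle\mathbf{i},\mathbf{j},\mathbf{k}\rangle$, and for $q_1,q_2\in\mathbb{H}$: $q_1(q_2\mathbf{l})=(q_2q_1)\mathbf{l}$, $(q_2\mathbf{l})q_1=(q_2\overline{q_1})\mathbf{l}$, $(q_1\mathbf{l})(q_2\mathbf{l})=-\overline{q_2}q_1$. $n$ is the octonion norm (also its polar form, $n(x,x)=n(x)$), $\mathbb{O}_0=\{1\}^\perp\equiv\mathbb{R}^7$ the trace-zero octonions, $x\times y=\mathrm{pr}_{\mathbb{O}_0}(xy)$ the cross product on $\mathbb{O}_0$,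 and $\Omega(x,y,z)=n(x,y\times z)$. $\mathrm{Aut}(\mathbb{O})$ is the group of algebra automorphisms; its elements preserve $\mathbb{O}_0$, $n$ and $\times$. $M_1':=\{W\le\mathbb{O}_0:\ \dim W=4,\ \Omega(W,W,W)=0\}$. *)

theory Defs
  imports "HOL-Analysis.Analysis" "HOL-Algebra.Group_Action" "HOL-Algebra.Left_Coset"
begin

section \<open>Quaternions and octonions\<close>

text \<open>
  Both algebras are realised on products of copies of the reals, so that the library's vector
  space structure and inner product are available.  The quaternion \<open>(a, b, c, d)\<close> is
  \<open>a + b i + c j + d k\<close>, and the octonion \<open>(p, q)\<close> is \<open>p + q l\<close>.
\<close>

type_synonym quat = "real \<times> real \<times> real \<times> real"
type_synonym octo = "quat \<times> quat"

fun qmul :: "quat \<Rightarrow> quat \<Rightarrow> quat" (infixl "*\<^sub>H" 70) where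
  "(a, b, c, d) *\<^sub>H (a', b', c', d') =
     (a * a' - b * b' - c * c' - d * d',
      a * b' + b * a' + c * d' - d * c',
      a * c' - b * d' + c * a' + d * b',
      a * d' + b * c' - c * b' + d * a')"

fun qcnj :: "quat \<Rightarrow> quat" where
  "qcnj (a, b, c, d) = (a, - b, - c, - d)"

definition q1 :: quat where "q1 = (1, 0, 0, 0)"
definition qi :: quat where "qi = (0, 1, 0, 0)"
definition qj :: quat where "qj = (0, 0, 1, 0)"
definition qk :: quat where "qk = (0, 0, 0, 1)"

fun omul :: "octo \<Rightarrow> octo \<Rightarrow> octo" (infixl "*\<^sub>O" 70) where
  "(p, q) *\<^sub>O (r, s) = (p *\<^sub>H r - qcnj s *\<^sub>H q, s *\<^sub>H p + q *\<^sub>H qcnj r)"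

definition o1 :: octo where "o1 = (q1, 0)"
definition ol :: octo where "ol = (0, q1)"

definition HH :: "octo set" where "HH = {(q, 0) | q. True}"
definition HHl :: "octo set" where "HHl = {(0, q) | q. True}"
definition HH0l :: "octo set" where "HH0l = {(0, q) | q. q \<in> span {qi, qj, qk}}"

text \<open>The octonion norm, in polar form; cf. \<open>omul_ocnj\<close> and \<open>oct_n_omul\<close> below.\<close>

definition oct_n :: "octo \<Rightarrow> octo \<Rightarrow> real" where
  "oct_n x y = x \<bullet> y"

lemma omul_rules:
  "(p, 0) *\<^sub>O (0, q) = (0, q *\<^sub>H p)"
  "(0, q) *\<^sub>O (p, 0) = (0, q *\<^sub>H qcnj p)"
  "(0, p) *\<^sub>O (0, q) = (- (qcnj q *\<^sub>H p), 0)"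
  by (cases p; cases q; simp add: zero_prod_def)+

lemma HHl_eq: "HHl = (\<lambda>x. x *\<^sub>O ol) ` HH"
proof -
  have "(q, 0) *\<^sub>O ol = (0, q)" for q :: quat
    by (cases q) (simp add: ol_def q1_def zero_prod_def)
  then show ?thesis by (auto simp: HHl_def HH_def image_iff)
qed

fun ocnj :: "octo \<Rightarrow> octo" where
  "ocnj (p, q) = (qcnj p, - q)"

lemma omul_ocnj: "x *\<^sub>O ocnj x = oct_n x x *\<^sub>R o1"
proof -
  obtain a b c d e f g h where "x = ((a, b, c, d), (e, f, g, h))"
    by (metis surj_pair)
  then show ?thesis
    by (simp add: oct_n_def o1_def q1_def zero_prod_def algebra_simps)
qed

lemma oct_n_omul: "oct_n (x *\<^sub>O y) (x *\<^sub>O y) = oct_n x x * oct_n y y"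
proof -
  obtain a b c d e f g h where x: "x = ((a, b, c, d), (e, f, g, h))"
    by (metis surj_pair)
  obtain a' b' c' d' e' f' g' h' where y: "y = ((a', b', c', d'), (e', f', g', h'))"
    by (metis surj_pair)
  show ?thesis
    unfolding x y by (simp add: oct_n_def) algebra
qed

definition orth_proj :: "'a::euclidean_space set \<Rightarrow> 'a \<Rightarrow> 'a" where
  "orth_proj V x = (THE y. y \<in> V \<and> (\<forall>z\<in>V. (x - y) \<bullet> z = 0))"

definition O0 :: "octo set" where
  "O0 = {x. oct_n o1 x = 0}"

definition ocross :: "octo \<Rightarrow> octo \<Rightarrow> octo" where
  "ocross x y = orth_proj O0 (x *\<^sub>O y)"

definition Omega :: "octo \<Rightarrow> octo \<Rightarrow> octo \<Rightarrow> real" where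
  "Omega x y z = oct_n x (ocross y z)"

definition M1' :: "octo set set" where
  "M1' = {W. subspace W \<and> W \<subseteq> O0 \<and> dim W = 4 \<and> (\<forall>x\<in>W. \<forall>y\<in>W. \<forall>z\<in>W. Omega x y z = 0)}"

definition M7 :: "(octo \<times> octo set) set" where
  "M7 = {(w, W). W \<in> M1' \<and> w \<in> W \<and> oct_n w w = 1}"


section \<open>The groups\<close>

definition AutO :: "(octo \<Rightarrow> octo) set" where
  "AutO = {f. linear f \<and> bij f \<and> (\<forall>x y. f (x *\<^sub>O y) = f x *\<^sub>O f y)}"

definition G2 :: "(octo \<Rightarrow> octo) monoid" where
  "G2 = \<lparr>carrier = AutO, mult = (\<circ>), one = id\<rparr>"

definition G2_act :: "(octo \<Rightarrow> octo) \<Rightarrow> octo \<times> octo set \<Rightarrow> octo \<times> octo set" where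
  "G2_act f = (\<lambda>(w, W)\<in>M7. (f w, f ` W))"

definition H7 :: "(octo \<Rightarrow> octo) set" where
  "H7 = {f \<in> AutO. f ` HH \<subseteq> HH \<and> f ol = ol}"

text \<open>
  \<open>has_det3 V g d\<close>: the linear endomorphism \<open>g\<close> of the 3-dimensional space \<open>V\<close> has determinant
  \<open>d\<close>, i.e. this is the determinant of its matrix in some (equivalently, any) basis \<open>b\<close> of \<open>V\<close>.
\<close>

definition has_det3 :: "octo set \<Rightarrow> (octo \<Rightarrow> octo) \<Rightarrow> real \<Rightarrow> bool" where
  "has_det3 V g d \<longleftrightarrow>
     (\<exists>(b :: 3 \<Rightarrow> octo) (A :: real^3^3).
        inj b \<and> independent (range b) \<and> span (range b) = V \<and>
        (\<forall>j. g (b j) = (\<Sum>i\<in>UNIV. A $ i $ j *\<^sub>R b i)) \<and> det A = d)"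

text \<open>The group \<open>SO(V, n)\<close> of a 3-dimensional subspace \<open>V\<close>.  Maps \<open>V \<rightarrow> V\<close> are represented by
  their extensional functions.\<close>

definition SO_sub :: "octo set \<Rightarrow> (octo \<Rightarrow> octo) monoid" where
  "SO_sub V = \<lparr>carrier =
       {g \<in> V \<rightarrow>\<^sub>E V.
          (\<forall>x\<in>V. \<forall>y\<in>V. g (x + y) = g x + g y) \<and>
          (\<forall>c. \<forall>x\<in>V. g (c *\<^sub>R x) = c *\<^sub>R g x) \<and>
          (\<forall>x\<in>V. oct_n (g x) (g x) = oct_n x x) \<and>
          has_det3 V g 1},
     mult = compose V, one = (\<lambda>x\<in>V. x)\<rparr>"

definition SO3 :: "(real^3^3) monoid" where
  "SO3 = \<lparr>carrier = {A. orthogonal_matrix A \<and> det A = 1}, mult = (**), one = mat 1\<rparr>"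


section \<open>Smooth structures\<close>

text \<open>
  A smooth structure is given as a sheaf of smooth real-valued functions on a topological space
  (a functionally structured space); smooth maps are the continuous maps that pull smooth
  functions back to smooth functions.  On smooth manifolds these are exactly the \<open>C\<^sup>\<infinity>\<close> maps.
  \<open>smooth_funs X U f\<close> only concerns the values of \<open>f\<close> on \<open>U\<close>.
\<close>

primrec Ck_on :: "nat \<Rightarrow> 'a::euclidean_space set \<Rightarrow> ('a \<Rightarrow> real) \<Rightarrow> bool" where
  "Ck_on 0 U f \<longleftrightarrow> continuous_on U f"
| "Ck_on (Suc k) U f \<longleftrightarrow>
     (\<forall>x\<in>U. f differentiable (at x)) \<and>
     (\<forall>v. Ck_on k U (\<lambda>x. frechet_derivative f (at x) v))"

definition Cinf_on :: "'a::euclidean_space set \<Rightarrow> ('a \<Rightarrow> real) \<Rightarrow> bool" where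
  "Cinf_on U f \<longleftrightarrow> (\<forall>k. Ck_on k U f)"

record 'a smooth_space =
  space_top :: "'a topology"
  smooth_funs :: "'a set \<Rightarrow> ('a \<Rightarrow> real) \<Rightarrow> bool"

definition smooth_map :: "'a smooth_space \<Rightarrow> 'b smooth_space \<Rightarrow> ('a \<Rightarrow> 'b) \<Rightarrow> bool" where
  "smooth_map X Y F \<longleftrightarrow>
     continuous_map (space_top X) (space_top Y) F \<and>
     (\<forall>V f. openin (space_top Y) V \<and> smooth_funs Y V f \<longrightarrow>
        smooth_funs X {x \<in> topspace (space_top X). F x \<in> V} (f \<circ> F))"

definition diffeomorphism :: "'a smooth_space \<Rightarrow> 'b smooth_space \<Rightarrow> ('a \<Rightarrow> 'b) \<Rightarrow> bool" where
  "diffeomorphism X Y F \<longleftrightarrow>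
     smooth_map X Y F \<and>
     (\<exists>G. smooth_map Y X G \<and>
        (\<forall>x\<in>topspace (space_top X). G (F x) = x) \<and>
        (\<forall>y\<in>topspace (space_top Y). F (G y) = y))"

definition diffeomorphic :: "'a smooth_space \<Rightarrow> 'b smooth_space \<Rightarrow> bool" where
  "diffeomorphic X Y \<longleftrightarrow> (\<exists>F. diffeomorphism X Y F)"

text \<open>
  The submanifold structure that \<open>S\<close> inherits from an injection \<open>e\<close> into a Euclidean space:
  subspace topology, and smooth functions are those that locally extend to \<open>C\<^sup>\<infinity>\<close> functions on
  open sets of the Euclidean space.
\<close>

definition embedded_space :: "'a set \<Rightarrow> ('a \<Rightarrow> 'e::euclidean_space) \<Rightarrow> 'a smooth_space" where
  "embedded_space S e =
     \<lparr>space_top = pullback_topology S e euclidean,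
      smooth_funs = (\<lambda>U f.
        openin (pullback_topology S e euclidean) U \<and>
        (\<forall>x\<in>U. \<exists>N g. open N \<and> e x \<in> N \<and> Cinf_on N g \<and> (\<forall>y\<in>U. e y \<in> N \<longrightarrow> f y = g (e y))))\<rparr>"

text \<open>
  The quotient structure along \<open>p\<close>: quotient topology, and \<open>f\<close> is smooth iff \<open>f \<circ> p\<close> is.  For the
  projection of a Lie group onto its cosets modulo a closed subgroup this is the usual manifold
  structure of the homogeneous space.
\<close>

definition quotient_top :: "('a \<Rightarrow> 'b) \<Rightarrow> 'a topology \<Rightarrow> 'b topology" where
  "quotient_top p T = topology (\<lambda>V. V \<subseteq> p ` topspace T \<and> openin T {x \<in> topspace T. p x \<in> V})"

lemma openin_quotient_top:
  "openin (quotient_top p T) V \<longleftrightarrow> V \<subseteq> p ` topspace T \<and> openin T {x \<in> topspace T. p x \<in> V}"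
proof -
  have "istopology (\<lambda>V. V \<subseteq> p ` topspace T \<and> openin T {x \<in> topspace T. p x \<in> V})"
    unfolding istopology_def
  proof (intro conjI allI impI; (elim conjE)?)
    fix A B
    assume "openin T {x \<in> topspace T. p x \<in> A}" "openin T {x \<in> topspace T. p x \<in> B}"
    then have "openin T ({x \<in> topspace T. p x \<in> A} \<inter> {x \<in> topspace T. p x \<in> B})" by blast
    also have "{x \<in> topspace T. p x \<in> A} \<inter> {x \<in> topspace T. p x \<in> B} =
        {x \<in> topspace T. p x \<in> A \<inter> B}" by blast
    finally show "openin T {x \<in> topspace T. p x \<in> A \<inter> B}" .
  next
    fix K
    assume *: "\<forall>V\<in>K. V \<subseteq> p ` topspace T \<and> openin T {x \<in> topspace T. p x \<in> V}"
    then have "openin T (\<Union>V\<in>K. {x \<in> topspace T. p x \<in> V})" by blast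
    also have "(\<Union>V\<in>K. {x \<in> topspace T. p x \<in> V}) = {x \<in> topspace T. p x \<in> \<Union>K}" by blast
    finally show "openin T {x \<in> topspace T. p x \<in> \<Union>K}" .
  qed blast+
  then show ?thesis by (simp add: quotient_top_def topology_inverse')
qed

definition quotient_space :: "('a \<Rightarrow> 'b) \<Rightarrow> 'a smooth_space \<Rightarrow> 'b smooth_space" where
  "quotient_space p X =
     \<lparr>space_top = quotient_top p (space_top X),
      smooth_funs = (\<lambda>V f.
        openin (quotient_top p (space_top X)) V \<and>
        smooth_funs X {x \<in> topspace (space_top X). p x \<in> V} (f \<circ> p))\<rparr>"

text \<open>Isomorphisms of Lie groups: \<open>X\<close>, \<open>Y\<close> are the smooth structures of the groups \<open>G\<close>, \<open>H\<close>.\<close>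

definition lie_iso ::
    "('a, 'c) monoid_scheme \<Rightarrow> 'a smooth_space \<Rightarrow> ('b, 'd) monoid_scheme \<Rightarrow> 'b smooth_space \<Rightarrow>
     ('a \<Rightarrow> 'b) set" where
  "lie_iso G X H Y = {h \<in> iso G H. diffeomorphism X Y h}"


section \<open>The manifolds\<close>

text \<open>Linear endomorphisms of the octonions are identified with their values on the basis
  \<open>1, i, j, k, l, il, jl, kl\<close>.\<close>

definition end_coords ::
    "(octo \<Rightarrow> octo) \<Rightarrow> octo \<times> octo \<times> octo \<times> octo \<times> octo \<times> octo \<times> octo \<times> octo" where
  "end_coords f =
     (f (q1, 0), f (qi, 0), f (qj, 0), f (qk, 0), f (0, q1), f (0, qi), f (0, qj), f (0, qk))"

definition G2_space :: "(octo \<Rightarrow> octo) smooth_space" where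
  "G2_space = embedded_space AutO end_coords"

definition H7_space :: "(octo \<Rightarrow> octo) smooth_space" where
  "H7_space = embedded_space H7 end_coords"

definition SO_HH0l_space :: "(octo \<Rightarrow> octo) smooth_space" where
  "SO_HH0l_space =
     embedded_space (carrier (SO_sub HH0l)) (\<lambda>g. (g (0, qi), g (0, qj), g (0, qk)))"

definition SO3_space :: "(real^3^3) smooth_space" where
  "SO3_space = embedded_space (carrier SO3) (\<lambda>A. A)"

text \<open>The Grassmannian carries its usual smooth structure, in which a subspace \<open>W\<close> is identified
  with the orthogonal projection onto \<open>W\<close>.\<close>

definition M7_space :: "(octo \<times> octo set) smooth_space" where
  "M7_space = embedded_space M7 (\<lambda>(w, W). (w, end_coords (orth_proj W)))"

definition G2_mod_H7_space :: "(octo \<Rightarrow> octo) set smooth_space" where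
  "G2_mod_H7_space = quotient_space (\<lambda>f. f <#\<^bsub>G2\<^esub> H7) G2_space"

end

(* Let w, x, y be orthonormal in W, a coassociative 4-plane.  Then (w x, w y, w) is a basic triple, so
   by Cayley-Dickson doubling there is an automorphism with i, j, l mapped to w x, w y, w.  It maps
   il, jl to x, y, and a coassociative 4-plane containing l, il, jl is Hl, so it moves (l, Hl) to (w, W).
   Choosing x, y by projecting a fixed frame to W and applying Gram-Schmidt makes the automorphism a
   smooth function of (w, W); these local sections make the orbit map a diffeomorphism.  The isotropy
   group consists of the maps p + q l -> R p + (R q) l with R in SO(3) acting on quaternions, because
   rotations are the orthogonal maps that preserve the cross product of R^3. *)

theory Submission
  imports Defs
begin

section \<open>Smooth maps between Euclidean spaces\<close>

text \<open>No charts occur: a smooth structure is a sheaf of functions on a set embedded in a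
  Euclidean space, or on a quotient of such a set. A map is therefore smooth once it is given
  locally by a smooth formula in ambient coordinates, and a map into the quotient once it lifts
  locally in this way. The formulas that arise are built from octonion products, inner products and
  normalisation of nonzero vectors. On the algebraic side the obstacle is non-associativity. Its
  substitute is the polarised alternative law, which yields the doubling rules for a unit imaginary
  \<open>c\<close> orthogonal to a quaternion subalgebra. For \<open>c = w\<close> the vanishing of
  \<Omega> on \<open>W\<close> supplies the orthogonality to \<open>w x\<close> and
  \<open>w y\<close>, and also to \<open>(w x)(w y)\<close>, because that last inner product with
  \<open>w\<close> equals \<open>y \<bullet> (w x)\<close>.\<close>

primrec Ck_map :: "nat \<Rightarrow> 'a::euclidean_space set \<Rightarrow> ('a \<Rightarrow> 'b::real_normed_vector) \<Rightarrow> bool" where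
  "Ck_map 0 U f \<longleftrightarrow> continuous_on U f"
| "Ck_map (Suc k) U f \<longleftrightarrow>
     (\<forall>x\<in>U. f differentiable (at x)) \<and> (\<forall>v. Ck_map k U (\<lambda>x. frechet_derivative f (at x) v))"

text \<open>Smooth structures speak of real functions only; vector values are added because charts
  of operators, frames and directional derivatives live in product spaces.\<close>

lemma Ck_map_real: "Ck_map k U f \<longleftrightarrow> Ck_on k U f"
  by (induction k arbitrary: f) auto

text \<open>On an open set the derivative at a point sees only values inside the set, so agreement
  passes to derivatives of every order.\<close>

lemma Ck_map_cong:
  assumes "open U" "Ck_map k U f" "\<And>x. x \<in> U \<Longrightarrow> f x = g x"
  shows "Ck_map k U g"
  using assms(2,3)
proof (induction k arbitrary: f g)
  case 0
  then show ?case by (simp cong: continuous_on_cong)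
next
  case (Suc k)
  have "g differentiable at x \<and> frechet_derivative f (at x) = frechet_derivative g (at x)"
    if "x \<in> U" for x
  proof -
    have *: "f differentiable at x" using Suc.prems that by auto
    then have "(g has_derivative frechet_derivative f (at x)) (at x)"
      using has_derivative_transform_within_open[OF _ assms(1) that Suc.prems(2)]
      by (simp add: frechet_derivative_works)
    with * show ?thesis
      using frechet_derivative_at differentiableI by blast
  qed
  note * = this
  have "Ck_map k U (\<lambda>x. frechet_derivative g (at x) v)" for v
    by (rule Suc.IH[of "\<lambda>x. frechet_derivative f (at x) v"]) (use Suc.prems(1) * in auto)
  with * show ?case by simp
qed

text \<open>By uniqueness of the derivative, any explicit formula may replace the chosen
  \<open>frechet_derivative\<close>. The inductions on \<open>k\<close> below run through this
  rule.\<close>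

lemma Ck_map_SucI:
  assumes "open U" "\<And>x. x \<in> U \<Longrightarrow> (f has_derivative f' x) (at x)"
    and "\<And>v. Ck_map k U (\<lambda>x. f' x v)"
  shows "Ck_map (Suc k) U f"
proof -
  have "f' x = frechet_derivative f (at x)" if "x \<in> U" for x
    using assms(2) that frechet_derivative_at by blast
  then have "Ck_map k U (\<lambda>x. frechet_derivative f (at x) v)" for v
    using Ck_map_cong[OF assms(1) assms(3)] by simp
  with assms(2) show ?thesis by (auto simp: differentiable_def)
qed

lemma Ck_map_has_derivative:
  "Ck_map (Suc k) U f \<Longrightarrow> x \<in> U \<Longrightarrow> (f has_derivative frechet_derivative f (at x)) (at x)"
  by (simp add: frechet_derivative_works)

lemma Ck_map_SucD: "Ck_map (Suc k) U f \<Longrightarrow> Ck_map k U f"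
proof (induction k arbitrary: f)
  case 0
  then show ?case
    by (auto intro!: continuous_at_imp_continuous_on differentiable_imp_continuous_within)
next
  case (Suc k)
  from Suc.prems have "\<forall>x\<in>U. f differentiable at x"
    and "\<And>v. Ck_map (Suc k) U (\<lambda>x. frechet_derivative f (at x) v)"
    by (simp_all only: Ck_map.simps) blast+
  with Suc.IH show ?case by simp
qed

lemma Ck_map_subset: "Ck_map k U f \<Longrightarrow> V \<subseteq> U \<Longrightarrow> Ck_map k V f"
  by (induction k arbitrary: f) (auto intro: continuous_on_subset)

lemma Ck_map_const: "open U \<Longrightarrow> Ck_map k U (\<lambda>x. c)"
proof (induction k arbitrary: c)
  case (Suc k)
  then show ?case
    by (intro Ck_map_SucI[where f' = "\<lambda>x h. 0"]) auto
qed simp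

lemma Ck_map_bounded_linear:
  assumes "bounded_linear L" "open U"
  shows "Ck_map k U L"
proof (cases k)
  case 0
  then show ?thesis by (simp add: assms linear_continuous_on)
next
  case (Suc j)
  show ?thesis unfolding Suc
    using assms by (intro Ck_map_SucI[where f' = "\<lambda>x. L"])
      (auto intro: bounded_linear_imp_has_derivative Ck_map_const)
qed

lemma Ck_map_add:
  assumes "open U"
  shows "Ck_map k U f \<Longrightarrow> Ck_map k U g \<Longrightarrow> Ck_map k U (\<lambda>x. f x + g x)"
proof (induction k arbitrary: f g)
  case (Suc k)
  show ?case
  proof (rule Ck_map_SucI[OF assms])
    show "((\<lambda>x. f x + g x) has_derivative
        (\<lambda>h. frechet_derivative f (at x) h + frechet_derivative g (at x) h)) (at x)"
      if "x \<in> U" for x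
      using Suc.prems that by (intro has_derivative_add Ck_map_has_derivative)
  qed (use Suc in auto)
qed (auto intro: continuous_on_add)

text \<open>Each summand of the product rule contains one undifferentiated factor, which
  \<open>Ck_map_SucD\<close> lowers to order \<open>k\<close>. Scaling, inner products and octonion
  multiplication are all instances.\<close>

lemma Ck_map_bilinear:
  assumes "open U" and B: "bounded_bilinear B"
  shows "Ck_map k U f \<Longrightarrow> Ck_map k U g \<Longrightarrow> Ck_map k U (\<lambda>x. B (f x) (g x))"
proof (induction k arbitrary: f g)
  case 0
  then show ?case by (simp add: bounded_bilinear.continuous_on[OF B])
next
  case (Suc k)
  show ?case
  proof (rule Ck_map_SucI[OF assms(1)])
    show "((\<lambda>x. B (f x) (g x)) has_derivative
        (\<lambda>h. B (f x) (frechet_derivative g (at x) h) + B (frechet_derivative f (at x) h) (g x)))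
        (at x)" if "x \<in> U" for x
      using Suc.prems that by (intro bounded_bilinear.FDERIV[OF B] Ck_map_has_derivative)
    have "Ck_map k U f" "Ck_map k U g"
      using Suc.prems Ck_map_SucD by blast+
    then show "Ck_map k U (\<lambda>x. B (f x) (frechet_derivative g (at x) v)
        + B (frechet_derivative f (at x) v) (g x))" for v
      using Suc.prems by (intro Ck_map_add[OF assms(1)] Suc.IH) auto
  qed
qed

lemma Ck_map_sum:
  assumes "open U" "finite I" "\<And>i. i \<in> I \<Longrightarrow> Ck_map k U (f i)"
  shows "Ck_map k U (\<lambda>x. \<Sum>i\<in>I. f i x)"
  using assms(2,3)
  by (induction I rule: finite_induct) (simp_all add: Ck_map_const Ck_map_add assms(1))

lemma Ck_map_compose:
  fixes f :: "'a::euclidean_space \<Rightarrow> 'b::euclidean_space"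
  assumes "open U" "open V" "f ` U \<subseteq> V"
  shows "Ck_map k U f \<Longrightarrow> Ck_map k V g \<Longrightarrow> Ck_map k U (\<lambda>x. g (f x))"
  using assms(3)
proof (induction k arbitrary: f g)
  case 0
  then show ?case by (auto intro: continuous_on_compose2)
next
  case (Suc k)
  let ?f' = "\<lambda>x. frechet_derivative f (at x)" and ?g' = "\<lambda>y. frechet_derivative g (at y)"
  \<comment> \<open>In the chain rule the direction \<open>?f' x v\<close> moves with
    \<open>x\<close>, whereas \<open>Ck_map\<close> controls derivatives in fixed directions only.
    Expanding the direction in \<open>Basis\<close> gives a finite sum of products to which the
    induction hypothesis applies.\<close>
  have dg: "(g has_derivative ?g' (f x)) (at (f x))" if "x \<in> U" for x
    using Suc.prems that by (intro Ck_map_has_derivative) auto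
  have lin: "?g' (f x) w = (\<Sum>b\<in>Basis. (w \<bullet> b) *\<^sub>R ?g' (f x) b)" if "x \<in> U" for x w
  proof -
    interpret linear "?g' (f x)" using dg[OF that] has_derivative_linear by blast
    have "?g' (f x) w = ?g' (f x) (\<Sum>b\<in>Basis. (w \<bullet> b) *\<^sub>R b)" by (simp add: euclidean_representation)
    then show ?thesis by (simp add: sum scale)
  qed
  show ?case
  proof (rule Ck_map_SucI[OF assms(1)])
    show "((\<lambda>x. g (f x)) has_derivative (\<lambda>h. ?g' (f x) (?f' x h))) (at x)" if "x \<in> U" for x
      by (rule has_derivative_compose[OF Ck_map_has_derivative[OF Suc.prems(1) that] dg[OF that]])
    fix v
    have "Ck_map k U f" using Suc.prems Ck_map_SucD by blast
    then have "Ck_map k U (\<lambda>x. \<Sum>b\<in>Basis. (?f' x v \<bullet> b) *\<^sub>R ?g' (f x) b)"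
      using Suc.prems
      by (intro Ck_map_sum assms finite_Basis Ck_map_bilinear[OF _ bounded_bilinear_scaleR]
          Ck_map_bilinear[OF _ bounded_bilinear_inner] Ck_map_const Suc.IH) auto
    then show "Ck_map k U (\<lambda>x. ?g' (f x) (?f' x v))"
      by (rule Ck_map_cong[OF assms(1)]) (simp add: lin[symmetric])
  qed
qed

text \<open>Openness is part of the notion, so that a smooth local formula on \<open>N\<close> also
  certifies that \<open>N\<close> is a neighbourhood of its points.\<close>

definition Cinf_map :: "'a::euclidean_space set \<Rightarrow> ('a \<Rightarrow> 'b::real_normed_vector) \<Rightarrow> bool" where
  "Cinf_map U f \<longleftrightarrow> open U \<and> (\<forall>k. Ck_map k U f)"

lemma Cinf_map_real: "Cinf_map U f \<longleftrightarrow> open U \<and> Cinf_on U f"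
  by (simp add: Cinf_map_def Cinf_on_def Ck_map_real)

lemma Cinf_map_continuous: "Cinf_map U f \<Longrightarrow> continuous_on U f"
  unfolding Cinf_map_def by (metis Ck_map.simps(1))

lemma Cinf_map_const: "open U \<Longrightarrow> Cinf_map U (\<lambda>x. c)"
  by (simp add: Cinf_map_def Ck_map_const)

lemma Cinf_map_subset: "Cinf_map U f \<Longrightarrow> open V \<Longrightarrow> V \<subseteq> U \<Longrightarrow> Cinf_map V f"
  unfolding Cinf_map_def using Ck_map_subset by blast

lemma Cinf_map_bilinear:
  "bounded_bilinear B \<Longrightarrow> Cinf_map U f \<Longrightarrow> Cinf_map U g \<Longrightarrow> Cinf_map U (\<lambda>x. B (f x) (g x))"
  by (simp add: Cinf_map_def Ck_map_bilinear)

lemmas Cinf_map_scaleR = Cinf_map_bilinear[OF bounded_bilinear_scaleR]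
  and Cinf_map_inner = Cinf_map_bilinear[OF bounded_bilinear_inner]

lemma Cinf_map_add: "Cinf_map U f \<Longrightarrow> Cinf_map U g \<Longrightarrow> Cinf_map U (\<lambda>x. f x + g x)"
  by (simp add: Cinf_map_def Ck_map_add)

lemma Cinf_map_compose:
  fixes f :: "'a::euclidean_space \<Rightarrow> 'b::euclidean_space"
  assumes "Cinf_map U f" "Cinf_map V g" "f ` U \<subseteq> V"
  shows "Cinf_map U (\<lambda>x. g (f x))"
  using assms by (auto simp: Cinf_map_def intro: Ck_map_compose)

lemma Cinf_map_linear:
  fixes f :: "'a::euclidean_space \<Rightarrow> 'b::euclidean_space"
  assumes "linear L" "Cinf_map U f"
  shows "Cinf_map U (\<lambda>x. L (f x))"
  by (rule Cinf_map_compose[where V = UNIV, OF assms(2)])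
    (use assms(1) in \<open>auto simp: Cinf_map_def Ck_map_bounded_linear linear_conv_bounded_linear\<close>)

lemma Cinf_map_id: "open U \<Longrightarrow> Cinf_map U (\<lambda>x. x)"
  by (simp add: Cinf_map_def Ck_map_bounded_linear)

lemma Cinf_map_diff:
  fixes f :: "'a::euclidean_space \<Rightarrow> 'b::euclidean_space"
  assumes "Cinf_map U f" "Cinf_map U g"
  shows "Cinf_map U (\<lambda>x. f x - g x)"
  using Cinf_map_add[OF assms(1) Cinf_map_linear[of "\<lambda>y. - y", OF _ assms(2)]]
  by (simp add: linear_iff)

lemma Cinf_map_Pair:
  fixes f :: "'a::euclidean_space \<Rightarrow> 'b::euclidean_space" and g :: "'a \<Rightarrow> 'c::euclidean_space"
  assumes "Cinf_map U f" "Cinf_map U g"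
  shows "Cinf_map U (\<lambda>x. (f x, g x))"
proof -
  have "linear (\<lambda>y. (y, 0 :: 'c))" "linear (\<lambda>z. (0 :: 'b, z))"
    by (simp_all add: linear_iff)
  from Cinf_map_add[OF Cinf_map_linear[OF this(1) assms(1)] Cinf_map_linear[OF this(2) assms(2)]]
  show ?thesis by simp
qed

lemma Cinf_map_fst:
  fixes f :: "'a::euclidean_space \<Rightarrow> 'b::euclidean_space \<times> 'c::euclidean_space"
  shows "Cinf_map U f \<Longrightarrow> Cinf_map U (\<lambda>x. fst (f x))"
  using Cinf_map_linear[OF linear_fst] by blast

lemma Cinf_map_snd:
  fixes f :: "'a::euclidean_space \<Rightarrow> 'b::euclidean_space \<times> 'c::euclidean_space"
  shows "Cinf_map U f \<Longrightarrow> Cinf_map U (\<lambda>x. snd (f x))"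
  using Cinf_map_linear[OF linear_snd] by blast

text \<open>Differentiation shifts the exponent and multiplies by a constant, so the induction has
  to keep \<open>a\<close> arbitrary.\<close>

lemma Cinf_map_powr: "Cinf_map {0<..} (\<lambda>t::real. t powr a)"
proof -
  have "Ck_map k {0<..} (\<lambda>t::real. t powr a)" for k
  proof (induction k arbitrary: a)
    case 0
    then show ?case by (auto intro!: continuous_intros)
  next
    case (Suc k)
    show ?case
    proof (rule Ck_map_SucI)
      show "((\<lambda>t. t powr a) has_derivative (\<lambda>h. h * (a * x powr (a - 1)))) (at x)"
        if "x \<in> {0<..}" for x
        using that has_real_derivative_powr[of x a]
        by (simp add: has_field_derivative_def mult.commute[of _ "a * x powr (a - 1)"])
      show "Ck_map k {0<..} (\<lambda>t. v * (a * t powr (a - 1)))" for v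
        by (intro Ck_map_bilinear[OF _ bounded_bilinear_mult] Ck_map_const Suc.IH) auto
    qed auto
  qed
  then show ?thesis by (simp add: Cinf_map_def)
qed

text \<open>The inverse norm is a real power of \<open>f x \<bullet> f x\<close>, which is positive
  on \<open>U\<close>; this avoids differentiating the norm itself.\<close>

lemma Cinf_map_sgn:
  fixes f :: "'a::euclidean_space \<Rightarrow> 'b::euclidean_space"
  assumes f: "Cinf_map U f" and nz: "\<And>x. x \<in> U \<Longrightarrow> f x \<noteq> 0"
  shows "Cinf_map U (\<lambda>x. sgn (f x))"
proof -
  have "(f x \<bullet> f x) powr (- 1 / 2) = inverse (norm (f x))" for x
  proof -
    have "(f x \<bullet> f x) powr (- 1 / 2) = inverse (sqrt (f x \<bullet> f x))"
      by (simp add: powr_minus powr_half_sqrt)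
    then show ?thesis by (simp add: norm_eq_sqrt_inner)
  qed
  moreover have "Cinf_map U (\<lambda>x. (f x \<bullet> f x) powr (- 1 / 2) *\<^sub>R f x)"
    using nz by (intro Cinf_map_scaleR f
        Cinf_map_compose[OF Cinf_map_inner[OF f f] Cinf_map_powr]) auto
  ultimately show ?thesis by (simp add: sgn_div_norm)
qed

section \<open>Smooth maps between embedded spaces and quotients\<close>

lemma openin_embedded:
  "openin (space_top (embedded_space S e)) U \<longleftrightarrow> (\<exists>N. open N \<and> U = {x \<in> S. e x \<in> N})"
  by (auto simp: embedded_space_def openin_pullback_topology open_openin[symmetric])

lemma topspace_embedded [simp]: "topspace (space_top (embedded_space S e)) = S"
  by (simp add: embedded_space_def topspace_pullback_topology)

lemma smooth_funs_embedded:
  "smooth_funs (embedded_space S e) U f \<longleftrightarrow>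
     (\<exists>N. open N \<and> U = {x \<in> S. e x \<in> N}) \<and>
     (\<forall>x\<in>U. \<exists>N g. e x \<in> N \<and> Cinf_map N g \<and> (\<forall>y\<in>U. e y \<in> N \<longrightarrow> f y = g (e y)))"
proof -
  have "openin (pullback_topology S e euclidean) U \<longleftrightarrow> (\<exists>N. open N \<and> U = {x \<in> S. e x \<in> N})"
    using openin_embedded[of S e U] by (simp add: embedded_space_def)
  then show ?thesis
    by (simp only: embedded_space_def smooth_space.simps Cinf_map_real) blast
qed

text \<open>A single ambient open set is recovered as the union of all ambient open sets that meet
  the image of \<open>S\<close> only in points coming from \<open>U\<close>.\<close>

lemma openin_embedded_local:
  "openin (space_top (embedded_space S e)) U \<longleftrightarrow>
     U \<subseteq> S \<and> (\<forall>x\<in>U. \<exists>N. open N \<and> e x \<in> N \<and> (\<forall>y\<in>S. e y \<in> N \<longrightarrow> y \<in> U))"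
proof
  assume R: "U \<subseteq> S \<and> (\<forall>x\<in>U. \<exists>N. open N \<and> e x \<in> N \<and> (\<forall>y\<in>S. e y \<in> N \<longrightarrow> y \<in> U))"
  let ?N = "\<Union>{N. open N \<and> (\<forall>y\<in>S. e y \<in> N \<longrightarrow> y \<in> U)}"
  have "open ?N" by auto
  moreover have "U = {x \<in> S. e x \<in> ?N}" using R by blast
  ultimately show "openin (space_top (embedded_space S e)) U" unfolding openin_embedded by blast
qed (auto simp: openin_embedded)

text \<open>If \<open>g\<close> extends \<open>f\<close> near \<open>e' (F x)\<close> and \<Phi>
  expresses \<open>F\<close> in ambient coordinates, then \<open>g (\<Phi> _)\<close> extends
  \<open>f \<circ> F\<close> near \<open>e x\<close>.\<close>

lemma smooth_map_embedded:
  assumes "\<And>x. x \<in> S \<Longrightarrow> F x \<in> S'"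
    and "\<And>x. x \<in> S \<Longrightarrow> \<exists>N \<Phi>. e x \<in> N \<and> Cinf_map N \<Phi> \<and> (\<forall>y\<in>S. e y \<in> N \<longrightarrow> e' (F y) = \<Phi> (e y))"
  shows "smooth_map (embedded_space S e) (embedded_space S' e') F"
proof -
  have pre: "\<exists>N \<Phi>. e x \<in> N \<and> open N \<and> Cinf_map N \<Phi> \<and> \<Phi> ` N \<subseteq> N' \<and>
     (\<forall>y\<in>S. e y \<in> N \<longrightarrow> e' (F y) = \<Phi> (e y))" if x: "x \<in> S" "e' (F x) \<in> N'" "open N'" for x N'
  proof -
    obtain N \<Phi> where N: "e x \<in> N" "Cinf_map N \<Phi>" "\<forall>y\<in>S. e y \<in> N \<longrightarrow> e' (F y) = \<Phi> (e y)"
      using assms(2) x(1) by blast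
    \<comment> \<open>Shrinking to the preimage of \<open>N'\<close> lets \<Phi> be composed with a
      function that is smooth only on \<open>N'\<close>.\<close>
    let ?M = "\<Phi> -` N' \<inter> N"
    have "open ?M"
      using N(2) x(3) Cinf_map_continuous[OF N(2)] continuous_on_open_vimage[of N \<Phi>]
      by (auto simp: Cinf_map_def Int_commute)
    then show ?thesis
      using N x by (intro exI[of _ ?M] exI[of _ \<Phi>]) (auto intro: Cinf_map_subset)
  qed
  have op: "openin (space_top (embedded_space S e)) {x \<in> S. F x \<in> V}"
    if V: "openin (space_top (embedded_space S' e')) V" for V
    unfolding openin_embedded_local
  proof (intro conjI ballI)
    fix x assume x: "x \<in> {x \<in> S. F x \<in> V}"
    from V obtain N' where N': "open N'" "V = {x \<in> S'. e' x \<in> N'}" unfolding openin_embedded by blast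
    with x pre[of x N'] obtain N \<Phi> where "e x \<in> N" "open N" "\<Phi> ` N \<subseteq> N'"
      "\<forall>y\<in>S. e y \<in> N \<longrightarrow> e' (F y) = \<Phi> (e y)" by auto
    then show "\<exists>N. open N \<and> e x \<in> N \<and> (\<forall>y\<in>S. e y \<in> N \<longrightarrow> y \<in> {x \<in> S. F x \<in> V})"
      using N' assms(1) by (intro exI[of _ N]) auto
  qed auto
  have "smooth_funs (embedded_space S e) {x \<in> S. F x \<in> V} (f \<circ> F)"
    if V: "openin (space_top (embedded_space S' e')) V"
      and f: "smooth_funs (embedded_space S' e') V f" for V f
    unfolding smooth_funs_embedded
  proof (intro conjI ballI)
    show "\<exists>N. open N \<and> {x \<in> S. F x \<in> V} = {x \<in> S. e x \<in> N}" using op[OF V] unfolding openin_embedded .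
    fix x assume x: "x \<in> {x \<in> S. F x \<in> V}"
    with f obtain N' g where N': "e' (F x) \<in> N'" "Cinf_map N' g" "\<forall>y\<in>V. e' y \<in> N' \<longrightarrow> f y = g (e' y)"
      unfolding smooth_funs_embedded by blast
    with x pre[of x N'] obtain N \<Phi> where N: "e x \<in> N" "Cinf_map N \<Phi>" "\<Phi> ` N \<subseteq> N'"
      "\<forall>y\<in>S. e y \<in> N \<longrightarrow> e' (F y) = \<Phi> (e y)" by (auto simp: Cinf_map_def)
    then have "Cinf_map N (\<lambda>x. g (\<Phi> x))" using N' Cinf_map_compose by blast
    then show "\<exists>N g. e x \<in> N \<and> Cinf_map N g \<and> (\<forall>y\<in>{x \<in> S. F x \<in> V}. e y \<in> N \<longrightarrow> (f \<circ> F) y = g (e y))"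
      using N N' by (intro exI[of _ N] exI[of _ "\<lambda>x. g (\<Phi> x)"]) auto
  qed
  then show ?thesis
    using op assms(1) by (auto simp: smooth_map_def continuous_map)
qed

lemma diffeomorphism_embedded:
  assumes "\<And>x. x \<in> S \<Longrightarrow> F x \<in> S' \<and> G (F x) = x" "\<And>y. y \<in> S' \<Longrightarrow> G y \<in> S \<and> F (G y) = y"
    and "Cinf_map UNIV \<Phi>" "\<And>x. x \<in> S \<Longrightarrow> e' (F x) = \<Phi> (e x)"
    and "Cinf_map UNIV \<Psi>" "\<And>y. y \<in> S' \<Longrightarrow> e (G y) = \<Psi> (e' y)"
  shows "diffeomorphism (embedded_space S e) (embedded_space S' e') F"
proof -
  have "smooth_map (embedded_space S e) (embedded_space S' e') F"
    using assms by (intro smooth_map_embedded) auto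
  moreover have "smooth_map (embedded_space S' e') (embedded_space S e) G"
    using assms by (intro smooth_map_embedded) auto
  ultimately show ?thesis using assms unfolding diffeomorphism_def by auto
qed

lemma smooth_funs_embedded_cong:
  assumes "\<And>x. x \<in> U \<Longrightarrow> f x = g x" "smooth_funs (embedded_space S e) U f"
  shows "smooth_funs (embedded_space S e) U g"
  using assms unfolding smooth_funs_embedded by simp

lemma quotient_topspace: "topspace (quotient_top p T) = p ` topspace T"
proof
  have "openin (quotient_top p T) (p ` topspace T)"
    by (simp add: openin_quotient_top Collect_mem_eq cong: conj_cong)
  then show "p ` topspace T \<subseteq> topspace (quotient_top p T)"
    by (rule openin_subset)
  show "topspace (quotient_top p T) \<subseteq> p ` topspace T"
    using openin_topspace[of "quotient_top p T"] unfolding openin_quotient_top by blast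
qed

text \<open>The local sections \<open>\<sigma>\<close> are what makes the inverse of the induced bijection smooth.\<close>

lemma diffeomorphic_quotient:
  fixes e :: "'s \<Rightarrow> 'e::euclidean_space" and e' :: "'m \<Rightarrow> 'f::euclidean_space"
  assumes q: "smooth_map (embedded_space S e) (embedded_space M e') q"
    and fib: "\<And>s t. s \<in> S \<Longrightarrow> t \<in> S \<Longrightarrow> p s = p t \<longleftrightarrow> q s = q t"
    and sec: "\<And>m. m \<in> M \<Longrightarrow> \<exists>N \<sigma> \<Phi>. e' m \<in> N \<and> Cinf_map N \<Phi> \<and>
      (\<forall>m'\<in>M. e' m' \<in> N \<longrightarrow> \<sigma> m' \<in> S \<and> q (\<sigma> m') = m' \<and> e (\<sigma> m') = \<Phi> (e' m'))"
  shows "diffeomorphic (embedded_space M e') (quotient_space p (embedded_space S e))"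
proof -
  let ?X = "embedded_space S e" and ?Y = "embedded_space M e'"
  let ?Q = "quotient_space p ?X"
  have qS: "q s \<in> M" if "s \<in> S" for s
    using q that by (auto simp: smooth_map_def continuous_map_def)
  have surj: "\<exists>s\<in>S. q s = m" if "m \<in> M" for m using sec[OF that] that by blast
  \<comment> \<open>By \<open>fib\<close> the maps \<open>p\<close> and \<open>q\<close> have the
    same fibres, so \<open>F\<close> and, below, \<open>G\<close> do not depend on the chosen
    preimages.\<close>
  define F where "F m = p (SOME s. s \<in> S \<and> q s = m)" for m
  have F: "F (q s) = p s" if "s \<in> S" for s
  proof -
    have "\<exists>t. t \<in> S \<and> q t = q s" using that by blast
    from someI_ex[OF this] show ?thesis using that fib unfolding F_def by blast
  qed
  define G where "G c = q (SOME s. s \<in> S \<and> p s = c)" for c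
  have G: "G (p s) = q s" if "s \<in> S" for s
  proof -
    have "\<exists>t. t \<in> S \<and> p t = p s" using that by blast
    from someI_ex[OF this] show ?thesis using that fib unfolding G_def by blast
  qed
  have topQ [simp]: "topspace (space_top ?Q) = p ` S"
    by (simp add: quotient_space_def quotient_topspace)
  have openQ: "openin (space_top ?Q) V \<longleftrightarrow> V \<subseteq> p ` S \<and> openin (space_top ?X) {s \<in> S. p s \<in> V}" for V
    by (simp add: quotient_space_def openin_quotient_top)
  have smoothQ: "smooth_funs ?Q V f \<longleftrightarrow> openin (space_top ?Q) V \<and> smooth_funs ?X {s \<in> S. p s \<in> V} (f \<circ> p)" for V f
    by (simp add: quotient_space_def)
  have GF: "{s \<in> S. p s \<in> {c \<in> p ` S. G c \<in> V}} = {s \<in> S. q s \<in> V}" for V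
    by (intro Collect_cong) (auto simp: G simp del: image_iff cong: conj_cong)
  \<comment> \<open>This direction is formal: \<open>G \<circ> p\<close> agrees with
    \<open>q\<close> on \<open>S\<close>, and openness and smoothness in the quotient are tested
    after composing with \<open>p\<close>.\<close>
  have "smooth_map ?Q ?Y G"
    unfolding smooth_map_def
  proof (intro conjI allI impI)
    show "continuous_map (space_top ?Q) (space_top ?Y) G"
      using q G qS by (auto simp: continuous_map openQ GF[unfolded mem_Collect_eq] smooth_map_def)
    fix V f assume V: "openin (space_top ?Y) V \<and> smooth_funs ?Y V f"
    then have "openin (space_top ?X) {s \<in> S. q s \<in> V}" "smooth_funs ?X {s \<in> S. q s \<in> V} (f \<circ> q)"
      using q by (auto simp: smooth_map_def continuous_map)
    then show "smooth_funs ?Q {c \<in> topspace (space_top ?Q). G c \<in> V} (f \<circ> G)"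
      unfolding topQ smoothQ openQ GF
      using G by (auto intro: smooth_funs_embedded_cong[of _ "f \<circ> q"])
  qed
  moreover have "smooth_map ?Y ?Q F"
  proof -
    define lift where "lift m N \<longleftrightarrow> (\<exists>N' \<sigma> \<Phi>. e' m \<in> N' \<and> Cinf_map N' \<Phi> \<and> \<Phi> ` N' \<subseteq> N \<and>
        (\<forall>m'\<in>M. e' m' \<in> N' \<longrightarrow> \<sigma> m' \<in> S \<and> F m' = p (\<sigma> m') \<and> e (\<sigma> m') = \<Phi> (e' m')))" for m N
    \<comment> \<open>The lift \<open>t\<close> of \<open>m\<close> is fixed before
      \<open>N\<close>. The set \<open>N\<close> is dictated by the open set or function under test
      near \<open>t\<close>, and the domain of the section is then shrunk to fit it.\<close>
    have loc: "\<exists>t\<in>S. q t = m \<and> (\<forall>N. open N \<and> e t \<in> N \<longrightarrow> lift m N)"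
      if m: "m \<in> M" for m
    proof -
      obtain N' \<sigma> \<Phi> where *: "e' m \<in> N'" "Cinf_map N' \<Phi>"
        "\<forall>m'\<in>M. e' m' \<in> N' \<longrightarrow> \<sigma> m' \<in> S \<and> q (\<sigma> m') = m' \<and> e (\<sigma> m') = \<Phi> (e' m')"
        using sec[OF m] by blast
      have Fp: "F m' = p (\<sigma> m')" if "m' \<in> M" "e' m' \<in> N'" for m'
        using * F that by metis
      show ?thesis
      proof (intro bexI[of _ "\<sigma> m"] conjI allI impI)
        fix N assume N: "open N \<and> e (\<sigma> m) \<in> N"
        let ?M = "\<Phi> -` N \<inter> N'"
        have "open ?M"
          using *(2) N Cinf_map_continuous[OF *(2)] continuous_on_open_vimage[of N' \<Phi>]
          by (auto simp: Cinf_map_def Int_commute)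
        moreover have "e' m \<in> ?M" using * N m by auto
        ultimately show "lift m N" unfolding lift_def
          using * Fp by (intro exI[of _ ?M] exI[of _ \<sigma>] exI[of _ \<Phi>]) (auto intro: Cinf_map_subset)
      qed (use * m in auto)
    qed
    have op: "openin (space_top ?Y) {m \<in> M. F m \<in> V}" if V: "openin (space_top ?Q) V" for V
      unfolding openin_embedded_local
    proof (intro conjI ballI)
      fix m assume m: "m \<in> {m \<in> M. F m \<in> V}"
      obtain N where N: "open N" "{s \<in> S. p s \<in> V} = {s \<in> S. e s \<in> N}"
        using V unfolding openQ openin_embedded by blast
      from loc m obtain t where t: "t \<in> S" "q t = m"
        and lift: "open N \<and> e t \<in> N \<longrightarrow> lift m N"
        by blast
      have "t \<in> {s \<in> S. p s \<in> V}" using F[OF t(1)] t m by auto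
      with N(2) have "e t \<in> N" by auto
      with N(1) lift have "lift m N" by blast
      then obtain N' \<sigma> \<Phi> where "e' m \<in> N'" "Cinf_map N' \<Phi>" "\<Phi> ` N' \<subseteq> N"
        "\<forall>m'\<in>M. e' m' \<in> N' \<longrightarrow> \<sigma> m' \<in> S \<and> F m' = p (\<sigma> m') \<and> e (\<sigma> m') = \<Phi> (e' m')"
        unfolding lift_def by blast
      with N(2) show "\<exists>N. open N \<and> e' m \<in> N \<and> (\<forall>m'\<in>M. e' m' \<in> N \<longrightarrow> m' \<in> {m \<in> M. F m \<in> V})"
        by (intro exI[of _ N']) (auto simp: Cinf_map_def)
    qed auto
    have "smooth_funs ?Y {m \<in> M. F m \<in> V} (f \<circ> F)"
      if V: "openin (space_top ?Q) V" and f: "smooth_funs ?Q V f" for V f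
      unfolding smooth_funs_embedded
    proof (intro conjI ballI)
      show "\<exists>N. open N \<and> {m \<in> M. F m \<in> V} = {m \<in> M. e' m \<in> N}"
        using op[OF V] unfolding openin_embedded .
      fix m assume m: "m \<in> {m \<in> M. F m \<in> V}"
      then obtain t where t: "t \<in> S" "q t = m"
        and lift: "\<And>N. open N \<and> e t \<in> N \<longrightarrow> lift m N"
        using loc by blast
      with m F have "t \<in> {s \<in> S. p s \<in> V}" by auto
      with f obtain N g where N: "e t \<in> N" "Cinf_map N g"
        "\<forall>s\<in>{s \<in> S. p s \<in> V}. e s \<in> N \<longrightarrow> (f \<circ> p) s = g (e s)"
        unfolding smoothQ smooth_funs_embedded by blast
      then have "lift m N" using lift by (simp add: Cinf_map_def)
      then obtain N' \<sigma> \<Phi> where N': "e' m \<in> N'" "Cinf_map N' \<Phi>" "\<Phi> ` N' \<subseteq> N"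
        "\<forall>m'\<in>M. e' m' \<in> N' \<longrightarrow> \<sigma> m' \<in> S \<and> F m' = p (\<sigma> m') \<and> e (\<sigma> m') = \<Phi> (e' m')"
        unfolding lift_def by blast
      have "(f \<circ> F) y = g (\<Phi> (e' y))" if "y \<in> M" "F y \<in> V" "e' y \<in> N'" for y
        using that N' N(3) by force
      with N' N show "\<exists>N g. e' m \<in> N \<and> Cinf_map N g \<and>
          (\<forall>y\<in>{m \<in> M. F m \<in> V}. e' y \<in> N \<longrightarrow> (f \<circ> F) y = g (e' y))"
        by (intro exI[of _ N'] exI[of _ "\<lambda>x. g (\<Phi> x)"]) (auto intro: Cinf_map_compose)
    qed
    moreover have "F m \<in> p ` S" if "m \<in> M" for m
      using surj[OF that] F by (metis imageI)
    ultimately show ?thesis using op by (auto simp: smooth_map_def continuous_map)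
  qed
  moreover have "G (F m) = m" if "m \<in> M" for m
    using surj[OF that] F G by metis
  moreover have "F (G c) = c" if "c \<in> p ` S" for c
    using that F G by auto
  ultimately show ?thesis
    unfolding diffeomorphic_def diffeomorphism_def
    by (intro exI[of _ F] conjI exI[of _ G]) auto
qed

section \<open>Octonion identities\<close>

lemma octo_cases:
  obtains a b c d e f g h where "x = ((a, b, c, d), (e, f, g, h) :: quat)"
  by (metis surj_pair)

lemma bounded_bilinear_omul: "bounded_bilinear (*\<^sub>O)"
  unfolding bilinear_conv_bounded_bilinear[symmetric] bilinear_def
proof (intro conjI allI linearI)
  fix x y z :: octo and r :: real
  show "x *\<^sub>O (y + z) = x *\<^sub>O y + x *\<^sub>O z" "(y + z) *\<^sub>O x = y *\<^sub>O x + z *\<^sub>O x"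
    by (cases x rule: octo_cases; cases y rule: octo_cases; cases z rule: octo_cases;
        simp add: algebra_simps)+
  show "x *\<^sub>O (r *\<^sub>R y) = r *\<^sub>R (x *\<^sub>O y)" "(r *\<^sub>R y) *\<^sub>O x = r *\<^sub>R (y *\<^sub>O x)"
    by (cases x rule: octo_cases; cases y rule: octo_cases; simp add: algebra_simps)+
qed

interpretation omul: bounded_bilinear "(*\<^sub>O)"
  by (rule bounded_bilinear_omul)

lemma linear_ocnj: "linear ocnj"
proof (rule linearI)
  fix x y :: octo and r :: real
  show "ocnj (x + y) = ocnj x + ocnj y"
    by (cases x rule: octo_cases; cases y rule: octo_cases) simp
  show "ocnj (r *\<^sub>R x) = r *\<^sub>R ocnj x"
    by (cases x rule: octo_cases) simp
qed

lemma ocnj_eq: "ocnj x = (2 * (x \<bullet> o1)) *\<^sub>R o1 - x"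
  by (cases x rule: octo_cases) (simp add: o1_def q1_def zero_prod_def)

lemma omul_one [simp]: "o1 *\<^sub>O x = x" "x *\<^sub>O o1 = x"
  by (cases x rule: octo_cases; simp add: o1_def q1_def zero_prod_def)+

lemma inner_o1_o1 [simp]: "o1 \<bullet> o1 = 1"
  by (simp add: o1_def q1_def)

lemma ocnj_o1 [simp]: "ocnj o1 = o1"
  by (simp add: o1_def q1_def)

lemma ocnj_ocnj [simp]: "ocnj (ocnj x) = x"
  by (cases x rule: octo_cases) simp

lemma ocnj_omul: "ocnj (x *\<^sub>O y) = ocnj y *\<^sub>O ocnj x"
  by (cases x rule: octo_cases; cases y rule: octo_cases; simp add: algebra_simps)

text \<open>This polarises the alternative law \<open>x (ocnj x z) = (x \<bullet> x) z\<close>. It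
  is checked in coordinates once and then takes the place of associativity.\<close>

lemma omul_ocnj_left: "x *\<^sub>O (ocnj y *\<^sub>O z) + y *\<^sub>O (ocnj x *\<^sub>O z) = (2 * (x \<bullet> y)) *\<^sub>R z"
  by (cases x rule: octo_cases; cases y rule: octo_cases; cases z rule: octo_cases;
      simp add: algebra_simps)

lemma inner_ocnj_ocnj: "ocnj x \<bullet> ocnj y = x \<bullet> y"
  by (cases x rule: octo_cases; cases y rule: octo_cases; simp)

text \<open>Conjugation reverses products, so this is the mirror image of the left-hand law.\<close>

lemma omul_ocnj_right: "(z *\<^sub>O ocnj y) *\<^sub>O x + (z *\<^sub>O ocnj x) *\<^sub>O y = (2 * (x \<bullet> y)) *\<^sub>R z"
proof -
  have "ocnj (ocnj x *\<^sub>O (y *\<^sub>O ocnj z) + ocnj y *\<^sub>O (x *\<^sub>O ocnj z)) = ocnj ((2 * (x \<bullet> y)) *\<^sub>R ocnj z)"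
    using omul_ocnj_left[of "ocnj x" "ocnj y" "ocnj z"] by (simp only: ocnj_ocnj inner_ocnj_ocnj)
  then show ?thesis
    by (simp only: linear_add[OF linear_ocnj] linear_scale[OF linear_ocnj] ocnj_omul ocnj_ocnj)
qed

lemma inner_omul_left: "(x *\<^sub>O y) \<bullet> z = y \<bullet> (ocnj x *\<^sub>O z)"
  by (cases x rule: octo_cases; cases y rule: octo_cases; cases z rule: octo_cases;
      simp add: algebra_simps)

lemma inner_omul_right: "(x *\<^sub>O y) \<bullet> z = x \<bullet> (z *\<^sub>O ocnj y)"
  by (cases x rule: octo_cases; cases y rule: octo_cases; cases z rule: octo_cases;
      simp add: algebra_simps)

lemma omul_self: "x *\<^sub>O x = (2 * (x \<bullet> o1)) *\<^sub>R x - (x \<bullet> x) *\<^sub>R o1"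
  by (cases x rule: octo_cases) (simp add: o1_def q1_def zero_prod_def algebra_simps)

lemma O0_iff: "x \<in> O0 \<longleftrightarrow> x \<bullet> o1 = 0"
  by (simp add: O0_def oct_n_def inner_commute)

lemma subspace_O0: "subspace O0"
  by (auto simp: subspace_def O0_iff inner_add_left)

lemma ocnj_O0: "x \<in> O0 \<Longrightarrow> ocnj x = - x"
  by (simp add: O0_iff ocnj_eq)

lemma inner_ocnj_O0: "c \<in> O0 \<Longrightarrow> ocnj x \<bullet> c = - (x \<bullet> c)"
  by (simp add: O0_iff ocnj_eq inner_diff_left inner_commute[of o1])

lemma omul_anticomm:
  assumes "x \<in> O0" "y \<in> O0" "x \<bullet> y = 0"
  shows "y *\<^sub>O x = - (x *\<^sub>O y)"
  using omul_ocnj_left[of x y o1] assms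
  by (simp add: ocnj_O0 omul.minus_right eq_neg_iff_add_eq_0 add.commute)

lemma omul_O0_cancel_left:
  assumes "x \<in> O0"
  shows "x *\<^sub>O (x *\<^sub>O z) = - (x \<bullet> x) *\<^sub>R z"
proof -
  have "2 *\<^sub>R (x *\<^sub>O (ocnj x *\<^sub>O z)) = 2 *\<^sub>R ((x \<bullet> x) *\<^sub>R z)"
    using omul_ocnj_left[of x x z] by (simp only: scaleR_2 scaleR_scaleR[symmetric])
  then have "x *\<^sub>O (ocnj x *\<^sub>O z) = (x \<bullet> x) *\<^sub>R z" unfolding scaleR_cancel_left by simp
  moreover have "x *\<^sub>O (x *\<^sub>O z) = - (x *\<^sub>O (ocnj x *\<^sub>O z))"
    using assms by (simp add: ocnj_O0 omul.minus_left omul.minus_right)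
  ultimately show ?thesis by simp
qed

lemma omul_O0_cancel_right:
  assumes "x \<in> O0"
  shows "(z *\<^sub>O x) *\<^sub>O x = - (x \<bullet> x) *\<^sub>R z"
proof -
  have "2 *\<^sub>R ((z *\<^sub>O ocnj x) *\<^sub>O x) = 2 *\<^sub>R ((x \<bullet> x) *\<^sub>R z)"
    using omul_ocnj_right[of z x x] by (simp only: scaleR_2 scaleR_scaleR[symmetric])
  then have "(z *\<^sub>O ocnj x) *\<^sub>O x = (x \<bullet> x) *\<^sub>R z" unfolding scaleR_cancel_left by simp
  moreover have "(z *\<^sub>O x) *\<^sub>O x = - ((z *\<^sub>O ocnj x) *\<^sub>O x)"
    using assms by (simp add: ocnj_O0 omul.minus_left omul.minus_right)
  ultimately show ?thesis by simp
qed

lemma inner_omul_omul: "(x *\<^sub>O y) \<bullet> (x *\<^sub>O y) = (x \<bullet> x) * (y \<bullet> y)"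
  using oct_n_omul by (simp add: oct_n_def)

declare omul.simps [simp del] split_paired_All [simp del] split_paired_Ex [simp del]

subsection \<open>The doubling rules for a unit vector orthogonal to a subalgebra\<close>

lemma omul_orth_swap:
  assumes "c \<in> O0" "v \<bullet> c = 0"
  shows "v *\<^sub>O c = c *\<^sub>O ocnj v"
  using omul_ocnj_left[of v c o1] assms by (simp add: ocnj_O0 omul.minus_right)

lemma omul_orth_left:
  assumes "c \<in> O0" "u \<bullet> c = 0"
  shows "u *\<^sub>O (c *\<^sub>O z) = c *\<^sub>O (ocnj u *\<^sub>O z)"
  using omul_ocnj_left[of u c z] assms by (simp add: ocnj_O0 omul.minus_right omul.minus_left)

lemma omul_orth_right:
  assumes "c \<in> O0" "v \<bullet> c = 0"
  shows "(u *\<^sub>O c) *\<^sub>O v = (u *\<^sub>O ocnj v) *\<^sub>O c"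
  using omul_ocnj_right[of u c v] assms by (simp add: ocnj_O0 omul.minus_right omul.minus_left)

text \<open>Moving \<open>c\<close> to the left of \<open>v\<close>, then out past \<open>u\<close>,
  costs one conjugation each. Moving it back to the right conjugates the product, which reverses the
  factors.\<close>

lemma omul_double_left:
  assumes "c \<in> O0" "u \<bullet> c = 0" "v \<bullet> c = 0" "(v *\<^sub>O u) \<bullet> c = 0"
  shows "u *\<^sub>O (v *\<^sub>O c) = (v *\<^sub>O u) *\<^sub>O c"
  using assms by (simp add: omul_orth_swap[of c v] omul_orth_left omul_orth_swap[of c "v *\<^sub>O u"] ocnj_omul)

text \<open>The polarised law for \<open>u c\<close> and \<open>- c\<close> turns the product into
  \<open>ocnj v\<close> times \<open>ocnj u\<close>, up to a correction by the real part of
  \<open>u\<close>. By \<open>ocnj_eq\<close> that correction is exactly what converts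
  \<open>ocnj u\<close> into \<open>- u\<close>.\<close>

lemma omul_double_double:
  assumes "c \<in> O0" "c \<bullet> c = 1" "u \<bullet> c = 0" "v \<bullet> c = 0" "(u *\<^sub>O v) \<bullet> c = 0"
  shows "(u *\<^sub>O c) *\<^sub>O (v *\<^sub>O c) = - (ocnj v *\<^sub>O u)"
proof -
  have "(u *\<^sub>O c) \<bullet> c = u \<bullet> o1"
    using assms by (simp add: inner_omul_right omul_ocnj oct_n_def)
  then have 1: "(u *\<^sub>O c) *\<^sub>O (c *\<^sub>O ocnj v) - c *\<^sub>O (ocnj (u *\<^sub>O c) *\<^sub>O ocnj v)
      = (- 2 * (u \<bullet> o1)) *\<^sub>R ocnj v"
    using omul_ocnj_left[of "u *\<^sub>O c" "- c" "ocnj v"] assms(1)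
    by (simp add: ocnj_O0 linear_neg[OF linear_ocnj] omul.minus_left)
  have "ocnj (u *\<^sub>O c) *\<^sub>O ocnj v = - ((u *\<^sub>O c) *\<^sub>O ocnj v)"
  proof -
    have "ocnj (u *\<^sub>O c) = - (c *\<^sub>O ocnj u)"
      using assms(1) by (simp add: ocnj_omul ocnj_O0 omul.minus_left)
    then show ?thesis by (simp add: omul_orth_swap[OF assms(1,3)] omul.minus_left)
  qed
  also have "(u *\<^sub>O c) *\<^sub>O ocnj v = (u *\<^sub>O v) *\<^sub>O c"
    using assms omul_orth_right[of c "ocnj v" u] by (simp add: inner_ocnj_O0)
  also have "\<dots> = c *\<^sub>O (ocnj v *\<^sub>O ocnj u)"
    using assms by (simp add: omul_orth_swap ocnj_omul)
  finally have "c *\<^sub>O (ocnj (u *\<^sub>O c) *\<^sub>O ocnj v) = ocnj v *\<^sub>O ocnj u"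
    using omul_O0_cancel_left[OF assms(1), of "ocnj v *\<^sub>O ocnj u"] assms(2) by (simp add: omul.minus_right)
  with 1 have "(u *\<^sub>O c) *\<^sub>O (v *\<^sub>O c) = ocnj v *\<^sub>O ocnj u - (2 * (u \<bullet> o1)) *\<^sub>R ocnj v"
    using assms by (simp add: omul_orth_swap[of c v] algebra_simps)
  also have "\<dots> = - (ocnj v *\<^sub>O u)"
    by (subst (2) ocnj_eq) (simp add: omul.diff_right omul.scaleR_right)
  finally show ?thesis .
qed

section \<open>Automorphisms from basic triples\<close>

fun oct_h :: "octo \<Rightarrow> octo \<Rightarrow> quat \<Rightarrow> octo" where
  "oct_h a b (p, q, r, s) = p *\<^sub>R o1 + q *\<^sub>R a + r *\<^sub>R b + s *\<^sub>R (a *\<^sub>O b)"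

text \<open>The linear map with \<open>1, i, j, l\<close> sent to \<open>o1, a, b, c\<close>; its
  values on the other basis elements are those forced by multiplicativity.\<close>

fun triple_map :: "octo \<Rightarrow> octo \<Rightarrow> octo \<Rightarrow> octo \<Rightarrow> octo" where
  "triple_map a b c (p, q) = oct_h a b p + oct_h a b q *\<^sub>O c"

lemma linear_oct_h: "linear (oct_h a b)"
  by (intro linearI; clarsimp simp: algebra_simps)

text \<open>These are the possible images of \<open>i, j, l\<close> under an automorphism. The last
  condition makes \<open>c\<close> orthogonal to the whole quaternion subalgebra generated by
  \<open>a\<close> and \<open>b\<close>.\<close>

locale basic_triple =
  fixes a b c :: octo
  assumes imag: "a \<in> O0" "b \<in> O0" "c \<in> O0"
    and unit: "a \<bullet> a = 1" "b \<bullet> b = 1" "c \<bullet> c = 1"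
    and orth: "a \<bullet> b = 0" "a \<bullet> c = 0" "b \<bullet> c = 0" "(a *\<^sub>O b) \<bullet> c = 0"
begin

lemma ab: "a *\<^sub>O b \<in> O0" "(a *\<^sub>O b) \<bullet> (a *\<^sub>O b) = 1"
  using imag unit orth
  by (simp_all add: O0_iff[of "a *\<^sub>O b"] inner_omul_left[of a b o1] ocnj_O0 inner_commute[of b a]
      inner_omul_omul)

lemma table:
  "a *\<^sub>O a = - o1" "b *\<^sub>O b = - o1" "(a *\<^sub>O b) *\<^sub>O (a *\<^sub>O b) = - o1"
  "b *\<^sub>O a = - (a *\<^sub>O b)" "a *\<^sub>O (a *\<^sub>O b) = - b" "(a *\<^sub>O b) *\<^sub>O a = b"
  "b *\<^sub>O (a *\<^sub>O b) = a" "(a *\<^sub>O b) *\<^sub>O b = - a"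
proof -
  show *: "b *\<^sub>O a = - (a *\<^sub>O b)" using imag orth by (intro omul_anticomm)
  have **: "a *\<^sub>O b = - (b *\<^sub>O a)" by (simp add: *)
  show "a *\<^sub>O a = - o1" "b *\<^sub>O b = - o1" "(a *\<^sub>O b) *\<^sub>O (a *\<^sub>O b) = - o1"
    using imag unit ab by (simp_all add: omul_self O0_iff)
  show "a *\<^sub>O (a *\<^sub>O b) = - b" "(a *\<^sub>O b) *\<^sub>O b = - a"
    using imag unit by (simp_all add: omul_O0_cancel_left omul_O0_cancel_right)
  show "(a *\<^sub>O b) *\<^sub>O a = b" "b *\<^sub>O (a *\<^sub>O b) = a"
    unfolding ** using imag unit
    by (simp_all add: omul_O0_cancel_left omul_O0_cancel_right omul.minus_left omul.minus_right)
qed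

lemma oct_h_omul: "oct_h a b p *\<^sub>O oct_h a b r = oct_h a b (p *\<^sub>H r)"
  by (cases p; cases r) (simp add: omul.add_left omul.add_right omul.scaleR_left omul.scaleR_right
      table algebra_simps)

lemma oct_h_orth: "oct_h a b p \<bullet> c = 0"
  using imag orth by (cases p) (simp add: inner_add_left O0_iff inner_commute[of o1 c])

lemma oct_h_ocnj: "ocnj (oct_h a b p) = oct_h a b (qcnj p)"
  using imag ab by (cases p)
    (simp add: linear_add[OF linear_ocnj] linear_scale[OF linear_ocnj] ocnj_O0)

text \<open>The image of \<open>oct_h a b\<close> is closed under products and conjugation and
  orthogonal to \<open>c\<close>, so the doubling rules apply to it and reproduce the terms of
  \<open>omul\<close> one by one.\<close>

lemma triple_map_omul: "triple_map a b c (x *\<^sub>O y) = triple_map a b c x *\<^sub>O triple_map a b c y"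
proof -
  obtain p q r s where xy: "x = (p, q)" "y = (r, s)" by (metis surj_pair)
  let ?h = "oct_h a b"
  have "?h p *\<^sub>O (?h s *\<^sub>O c) = ?h (s *\<^sub>H p) *\<^sub>O c"
    using omul_double_left[of c "?h p" "?h s"] imag by (simp add: oct_h_orth oct_h_omul)
  moreover have "(?h q *\<^sub>O c) *\<^sub>O ?h r = ?h (q *\<^sub>H qcnj r) *\<^sub>O c"
    using omul_orth_right[of c "?h r" "?h q"] imag by (simp add: oct_h_orth oct_h_omul oct_h_ocnj)
  moreover have "(?h q *\<^sub>O c) *\<^sub>O (?h s *\<^sub>O c) = - ?h (qcnj s *\<^sub>H q)"
    using omul_double_double[of c "?h q" "?h s"] imag unit
    by (simp add: oct_h_orth oct_h_omul oct_h_ocnj)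
  ultimately show ?thesis
    by (simp add: xy omul.simps omul.add_left omul.add_right oct_h_omul linear_add[OF linear_oct_h]
        linear_diff[OF linear_oct_h])
qed

text \<open>Injectivity comes from multiplicativity: if \<open>x\<close> is killed, so is
  \<open>x *\<^sub>O ocnj x\<close>, a multiple of \<open>o1\<close>, while \<open>o1\<close> is
  fixed. Surjectivity then follows by finite dimension.\<close>

lemma triple_map_AutO: "triple_map a b c \<in> AutO"
proof -
  have lin: "linear (triple_map a b c)"
    by (intro linearI; clarsimp simp only: split_paired_all add_Pair scaleR_Pair triple_map.simps
        linear_add[OF linear_oct_h] linear_scale[OF linear_oct_h] omul.add_left omul.scaleR_left)
      (simp_all add: algebra_simps)
  have "x = 0" if "triple_map a b c x = 0" for x
  proof -
    have "triple_map a b c (x *\<^sub>O ocnj x) = 0"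
      by (simp add: triple_map_omul that omul.zero_left)
    moreover have "triple_map a b c o1 = o1"
      unfolding o1_def triple_map.simps linear_0[OF linear_oct_h]
      by (simp add: q1_def omul.zero_left) (simp add: o1_def q1_def)
    ultimately have "(x \<bullet> x) *\<^sub>R o1 = 0"
      by (simp add: omul_ocnj oct_n_def linear_scale[OF lin])
    then show ?thesis by (auto simp: o1_def q1_def zero_prod_def)
  qed
  with lin have "bij (triple_map a b c)"
    by (simp add: bij_def linear_injective_0 linear_injective_imp_surjective)
  with lin show ?thesis unfolding AutO_def using triple_map_omul by blast
qed

end

section \<open>Automorphisms of the octonions\<close>

lemma AutO_linear: "f \<in> AutO \<Longrightarrow> linear f"
  and AutO_bij: "f \<in> AutO \<Longrightarrow> bij f"
  and AutO_inj: "f \<in> AutO \<Longrightarrow> inj f"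
  and AutO_omul: "f \<in> AutO \<Longrightarrow> f (x *\<^sub>O y) = f x *\<^sub>O f y"
  unfolding AutO_def by (blast intro: bij_is_inj)+

lemma AutO_id: "id \<in> AutO"
  by (simp add: AutO_def linear_id)

lemma AutO_comp: "f \<in> AutO \<Longrightarrow> g \<in> AutO \<Longrightarrow> f \<circ> g \<in> AutO"
  by (simp add: AutO_def linear_compose bij_comp)

lemma AutO_inv:
  assumes "f \<in> AutO"
  shows "inv_into UNIV f \<in> AutO"
proof -
  have f: "f (inv_into UNIV f x) = x" "inv_into UNIV f (f x) = x" for x
    using AutO_bij[OF assms] by (simp_all add: bij_is_surj surj_f_inv_f bij_is_inj)
  have "inv_into UNIV f (x *\<^sub>O y) = inv_into UNIV f x *\<^sub>O inv_into UNIV f y" for x y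
    using AutO_omul[OF assms, of "inv_into UNIV f x" "inv_into UNIV f y"] f by metis
  then show ?thesis
    using assms by (simp add: AutO_def bij_imp_bij_inv linear_injective_left_inverse
        inj_linear_imp_inv_linear bij_is_inj)
qed

lemma AutO_one:
  assumes "f \<in> AutO"
  shows "f o1 = o1"
proof -
  obtain y where "f y = o1" using AutO_bij[OF assms] by (metis bij_pointE)
  then show ?thesis using AutO_omul[OF assms, of o1 y] by simp
qed

text \<open>The square of an octonion is a nonpositive multiple of the unit exactly for the
  imaginary octonions, so that automorphisms preserve these and their norm.\<close>

lemma AutO_imag:
  assumes f: "f \<in> AutO" and x: "x \<in> O0"
  shows "f x \<in> O0" "f x \<bullet> f x = x \<bullet> x"
proof -
  note lin = AutO_linear[OF f]
  let ?v = "f x"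
  have "?v *\<^sub>O ?v = - (x \<bullet> x) *\<^sub>R o1"
    using AutO_omul[OF f, of x x, symmetric] x
    by (simp add: omul_self[of x] O0_iff linear_neg[OF lin] linear_scale[OF lin] AutO_one[OF f])
  then have sq: "(2 * (?v \<bullet> o1)) *\<^sub>R ?v = (?v \<bullet> ?v - x \<bullet> x) *\<^sub>R o1"
    by (simp add: omul_self[of ?v] scaleR_left_diff_distrib algebra_simps)
  \<comment> \<open>With a nonzero real part, \<open>sq\<close> would make \<open>f x\<close> a real
    multiple of \<open>o1\<close>. Injectivity would make the imaginary \<open>x\<close> one too,
    hence zero.\<close>
  have t: "?v \<bullet> o1 = 0"
  proof (rule ccontr)
    assume nz: "?v \<bullet> o1 \<noteq> 0"
    define s where "s = (?v \<bullet> ?v - x \<bullet> x) / (2 * (?v \<bullet> o1))"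
    have "?v = (1 / (2 * (?v \<bullet> o1))) *\<^sub>R ((2 * (?v \<bullet> o1)) *\<^sub>R ?v)"
      using nz by simp
    also have "\<dots> = s *\<^sub>R o1" unfolding sq by (simp add: s_def)
    finally have v: "?v = s *\<^sub>R o1" .
    also have "\<dots> = f (s *\<^sub>R o1)" by (simp add: linear_scale[OF lin] AutO_one[OF f])
    finally have "x = s *\<^sub>R o1" using AutO_inj[OF f] by (simp add: inj_eq)
    with x have "s = 0" by (simp add: O0_iff)
    with v nz show False by simp
  qed
  then show "?v \<in> O0" by (simp add: O0_iff)
  from sq t have "(?v \<bullet> ?v - x \<bullet> x) *\<^sub>R o1 = 0" by simp
  then show "?v \<bullet> ?v = x \<bullet> x" by (auto simp: o1_def q1_def zero_prod_def)
qed

text \<open>Splitting off the real part reduces the squared norm to the imaginary case; polarisation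
  then gives the inner product.\<close>

lemma AutO_inner:
  assumes f: "f \<in> AutO"
  shows "f x \<bullet> f y = x \<bullet> y"
proof -
  note lin = AutO_linear[OF f]
  have sq: "f x \<bullet> f x = x \<bullet> x" for x
  proof -
    define u where "u = x - (x \<bullet> o1) *\<^sub>R o1"
    have x: "x = (x \<bullet> o1) *\<^sub>R o1 + u" by (simp add: u_def)
    have u: "u \<in> O0" by (simp add: u_def O0_iff inner_diff_left)
    have fx: "f x = (x \<bullet> o1) *\<^sub>R o1 + f u"
      by (subst x) (simp add: linear_add[OF lin] linear_scale[OF lin] AutO_one[OF f])
    have "f u \<bullet> o1 = 0" "u \<bullet> o1 = 0" using u AutO_imag(1)[OF f u] by (simp_all add: O0_iff)
    moreover have "y \<bullet> y = t * t + v \<bullet> v" if "y = t *\<^sub>R o1 + v" "v \<bullet> o1 = 0" for y v t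
      using that by (simp add: inner_add_left inner_add_right inner_commute[of o1 v])
    ultimately have "f x \<bullet> f x = (x \<bullet> o1) * (x \<bullet> o1) + f u \<bullet> f u"
      "x \<bullet> x = (x \<bullet> o1) * (x \<bullet> o1) + u \<bullet> u"
      using fx x by blast+
    then show ?thesis by (simp add: AutO_imag(2)[OF f u])
  qed
  have "f (x + y) \<bullet> f (x + y) = (x + y) \<bullet> (x + y)" by (rule sq)
  then show ?thesis
    by (simp add: linear_add[OF lin] inner_add_left inner_add_right sq inner_commute)
qed

section \<open>The action on coassociative subspaces\<close>

lemma orth_proj_eqI:
  assumes V: "subspace V" and y: "y \<in> V" "\<And>z. z \<in> V \<Longrightarrow> (x - y) \<bullet> z = 0"
  shows "orth_proj V x = y"
  unfolding orth_proj_def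
proof (rule the_equality)
  fix y' assume y': "y' \<in> V \<and> (\<forall>z\<in>V. (x - y') \<bullet> z = 0)"
  with y have "y - y' \<in> V" using V subspace_diff by blast
  with y y' have "(x - y') \<bullet> (y - y') - (x - y) \<bullet> (y - y') = 0" by simp
  then have "(y - y') \<bullet> (y - y') = 0" by (simp add: inner_diff_left)
  then show "y' = y" by simp
qed (use y in auto)

lemma orth_proj:
  fixes V :: "'a::euclidean_space set"
  assumes V: "subspace V"
  shows "orth_proj V x \<in> V" "z \<in> V \<Longrightarrow> (x - orth_proj V x) \<bullet> z = 0"
proof -
  obtain y d where "y \<in> span V" "\<And>w. w \<in> span V \<Longrightarrow> orthogonal d w" "x = y + d"
    using orthogonal_subspace_decomp_exists[of V x] by blast
  then have *: "y \<in> V" "\<And>z. z \<in> V \<Longrightarrow> (x - y) \<bullet> z = 0"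
    using V by (simp_all add: span_eq_iff[THEN iffD2] orthogonal_def)
  then have "orth_proj V x = y" using orth_proj_eqI[OF V] by blast
  with * show "orth_proj V x \<in> V" "z \<in> V \<Longrightarrow> (x - orth_proj V x) \<bullet> z = 0" by auto
qed

lemma linear_orth_proj:
  fixes V :: "'a::euclidean_space set"
  assumes "subspace V"
  shows "linear (orth_proj V)"
proof (rule linearI; rule orth_proj_eqI[OF assms])
  fix x y :: 'a and r :: real
  show "orth_proj V x + orth_proj V y \<in> V" "r *\<^sub>R orth_proj V x \<in> V"
    using assms by (simp_all add: subspace_add subspace_scale orth_proj)
  show "(x + y - (orth_proj V x + orth_proj V y)) \<bullet> z = 0" if "z \<in> V" for z
    using orth_proj(2)[OF assms that, of x] orth_proj(2)[OF assms that, of y]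
    by (simp add: inner_diff_left inner_add_left)
  show "(r *\<^sub>R x - r *\<^sub>R orth_proj V x) \<bullet> z = 0" if "z \<in> V" for z
    using orth_proj(2)[OF assms that, of x] by (simp add: inner_diff_left)
qed

text \<open>The projection in the cross product discards only a component orthogonal to
  \<open>x\<close>, so \<Omega> can be computed with the full octonion product.\<close>

lemma Omega_O0:
  assumes "x \<in> O0"
  shows "Omega x y z = x \<bullet> (y *\<^sub>O z)"
proof -
  have "(y *\<^sub>O z - orth_proj O0 (y *\<^sub>O z)) \<bullet> x = 0"
    using orth_proj(2)[OF subspace_O0 assms] .
  then show ?thesis
    by (simp add: Omega_def oct_n_def ocross_def inner_diff_left inner_commute[of x])
qed

lemma M1'_iff:
  "W \<in> M1' \<longleftrightarrow> subspace W \<and> W \<subseteq> O0 \<and> dim W = 4 \<and> (\<forall>x\<in>W. \<forall>y\<in>W. \<forall>z\<in>W. x \<bullet> (y *\<^sub>O z) = 0)"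
proof -
  have "Omega x y z = x \<bullet> (y *\<^sub>O z)" if "W \<subseteq> O0" "x \<in> W" for x y z
    using Omega_O0 that by blast
  then show ?thesis unfolding M1'_def by (simp cong: conj_cong)
qed

lemma M1'_image:
  assumes f: "f \<in> AutO" and W: "W \<in> M1'"
  shows "f ` W \<in> M1'"
proof -
  have "dim (f ` W) = dim W"
    using f by (intro dim_image_eq AutO_linear inj_on_subset[OF AutO_inj]) auto
  moreover have "f ` W \<subseteq> O0"
    using W AutO_imag(1)[OF f] by (auto simp: M1'_iff)
  moreover have "f x \<bullet> (f y *\<^sub>O f z) = 0" if "x \<in> W" "y \<in> W" "z \<in> W" for x y z
    using that W by (simp add: AutO_omul[OF f, symmetric] AutO_inner[OF f] M1'_iff)
  ultimately show ?thesis
    using W AutO_linear[OF f] by (auto simp: M1'_iff linear_subspace_image)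
qed

lemma M7_image: "f \<in> AutO \<Longrightarrow> (w, W) \<in> M7 \<Longrightarrow> (f w, f ` W) \<in> M7"
  by (auto simp: M7_def M1'_image oct_n_def AutO_inner)

lemma HHl_M1': "HHl \<in> M1'"
proof -
  have lin: "linear (\<lambda>q :: quat. (0 :: quat, q))" by (simp add: linear_iff)
  have HHl: "HHl = range (\<lambda>q. (0, q))" by (auto simp: HHl_def)
  have "dim HHl = 4"
    unfolding HHl by (subst dim_image_eq[OF lin]) (auto simp: inj_on_def)
  moreover have "subspace HHl"
    unfolding HHl using lin by (intro linear_subspace_image) auto
  moreover have "HHl \<subseteq> O0"
    by (auto simp: HHl_def O0_iff o1_def)
  moreover have "x \<bullet> (y *\<^sub>O z) = 0" if "x \<in> HHl" "y \<in> HHl" "z \<in> HHl" for x y z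
    using that by (auto simp: HHl_def omul_rules simp del: omul.simps)
  ultimately show ?thesis by (simp add: M1'_iff)
qed

lemma base_point_M7: "(ol, HHl) \<in> M7"
  using HHl_M1' by (auto simp: M7_def HHl_def ol_def oct_n_def q1_def)

text \<open>Up to sign, the products of l, il, jl in pairs are i, j, k. Vanishing of \<Omega> and
  membership in \<open>O0\<close> thus make \<open>W\<close> orthogonal to all of \<open>HH\<close>,
  and the dimensions agree.\<close>

lemma M1'_eq_HHl:
  assumes W: "W \<in> M1'" and *: "(0, q1) \<in> W" "(0, qi) \<in> W" "(0, qj) \<in> W"
  shows "W = HHl"
proof (rule subspace_dim_equal)
  show "W \<subseteq> HHl"
  proof
    fix v assume v: "v \<in> W"
    obtain p q where pq: "v = (p, q)" by (metis surj_pair)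
    have "v \<bullet> (x *\<^sub>O y) = 0" if "x \<in> W" "y \<in> W" for x y
      using W v that by (auto simp: M1'_iff)
    from this[OF *(1,2)] this[OF *(1,3)] this[OF *(2,3)]
    have "v \<bullet> o1 = 0" "v \<bullet> ((0, q1) *\<^sub>O (0, qi)) = 0" "v \<bullet> ((0, q1) *\<^sub>O (0, qj)) = 0"
      "v \<bullet> ((0, qi) *\<^sub>O (0, qj)) = 0"
      using W v by (auto simp: M1'_iff O0_iff)
    then have "p \<bullet> q1 = 0" "p \<bullet> qi = 0" "p \<bullet> qj = 0" "p \<bullet> qk = 0"
      by (simp_all add: pq o1_def omul_rules q1_def qi_def qj_def qk_def) (cases p; simp)
    then have "p = 0"
      by (cases p) (simp add: q1_def qi_def qj_def qk_def zero_prod_def)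
    then show "v \<in> HHl" by (simp add: HHl_def pq)
  qed
qed (use W HHl_M1' in \<open>auto simp: M1'_iff\<close>)

lemma M7_frame:
  assumes wW: "(w, W) \<in> M7" and x: "x \<in> W" "y \<in> W"
    and on: "x \<bullet> x = 1" "y \<bullet> y = 1" "w \<bullet> x = 0" "w \<bullet> y = 0" "x \<bullet> y = 0"
  defines "f \<equiv> triple_map (w *\<^sub>O x) (w *\<^sub>O y) w"
  shows "f \<in> AutO" "(f ol, f ` HHl) = (w, W)"
proof -
  have W: "W \<in> M1'" "w \<in> W" "w \<bullet> w = 1" using wW by (auto simp: M7_def oct_n_def)
  have imag: "w \<in> O0" "x \<in> O0" "y \<in> O0" using W x by (auto simp: M1'_iff)
  have \<Omega>: "u \<bullet> (v *\<^sub>O z) = 0" if "u \<in> W" "v \<in> W" "z \<in> W" for u v z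
    using W(1) that by (auto simp: M1'_iff)
  have one: "o1 \<bullet> w = 0" "w \<bullet> o1 = 0" using imag by (simp_all add: O0_iff inner_commute)
  interpret T: basic_triple "w *\<^sub>O x" "w *\<^sub>O y" w
  proof
    show "w *\<^sub>O x \<in> O0" "w *\<^sub>O y \<in> O0"
      using imag on by (simp_all add: O0_iff[of "w *\<^sub>O _"] inner_omul_left ocnj_O0 inner_commute[of _ w])
    show "(w *\<^sub>O x) \<bullet> (w *\<^sub>O x) = 1" "(w *\<^sub>O y) \<bullet> (w *\<^sub>O y) = 1"
      using on W by (simp_all add: inner_omul_omul)
    show "(w *\<^sub>O x) \<bullet> (w *\<^sub>O y) = 0"
      using imag W on by (simp add: inner_omul_left ocnj_O0 omul.minus_left omul_O0_cancel_left)
    show "(w *\<^sub>O x) \<bullet> w = 0" "(w *\<^sub>O y) \<bullet> w = 0"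
      using \<Omega> W x by (simp_all add: inner_commute[of "w *\<^sub>O x" w] inner_commute[of "w *\<^sub>O y" w])
    show "((w *\<^sub>O x) *\<^sub>O (w *\<^sub>O y)) \<bullet> w = 0"
    proof -
      have O0: "w *\<^sub>O y \<in> O0" by fact
      \<comment> \<open>Right multiplication by the imaginary \<open>w y\<close> is skew, and
        \<open>w (w y) = - y\<close> for a unit imaginary \<open>w\<close>; what remains is a value
        of \<Omega> on \<open>W\<close>.\<close>
      have "((w *\<^sub>O x) *\<^sub>O (w *\<^sub>O y)) \<bullet> w = - ((w *\<^sub>O x) \<bullet> (w *\<^sub>O (w *\<^sub>O y)))"
        by (simp add: inner_omul_right[of "w *\<^sub>O x"] ocnj_O0[OF O0] omul.minus_right)
      also have "\<dots> = y \<bullet> (w *\<^sub>O x)"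
        using imag W by (simp add: omul_O0_cancel_left inner_commute)
      also have "\<dots> = 0" using \<Omega> W x by blast
      finally show ?thesis .
    qed
  qed (use imag W in auto)
  show f: "f \<in> AutO" unfolding f_def by (rule T.triple_map_AutO)
  \<comment> \<open>The triple map sends \<open>il\<close> to \<open>(w x) w\<close>. The order
    \<open>w x\<close> in the triple is the one for which this is \<open>x\<close> and not
    \<open>- x\<close>.\<close>
  have cancel: "(w *\<^sub>O z) *\<^sub>O w = z" if "z \<in> O0" "w \<bullet> z = 0" for z
  proof -
    have "w *\<^sub>O z = - (z *\<^sub>O w)" using omul_anticomm[OF imag(1) that] by simp
    then show ?thesis using imag W by (simp add: omul.minus_left omul_O0_cancel_right)
  qed
  have fl: "f (0, q1) = w" "f (0, qi) = x" "f (0, qj) = y"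
    unfolding f_def triple_map.simps linear_0[OF linear_oct_h]
    by (simp_all add: q1_def qi_def qj_def cancel imag on)
  have inv: "inv_into UNIV f w = (0, q1)" "inv_into UNIV f x = (0, qi)" "inv_into UNIV f y = (0, qj)"
    using fl AutO_inj[OF f] by (metis inv_f_f)+
  \<comment> \<open>Pulling \<open>W\<close> back gives a coassociative 4-plane through l, il, jl,
    which leaves no choice but \<open>HHl\<close>.\<close>
  have "inv_into UNIV f ` W \<in> M1'" using M1'_image[OF AutO_inv[OF f] W(1)] .
  moreover have "(0, q1) \<in> inv_into UNIV f ` W" "(0, qi) \<in> inv_into UNIV f ` W" "(0, qj) \<in> inv_into UNIV f ` W"
    using inv W x by (metis imageI)+
  ultimately have "inv_into UNIV f ` W = HHl" by (rule M1'_eq_HHl)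
  then have "f ` HHl = W" using AutO_bij[OF f] by (metis bij_is_surj image_f_inv_f)
  then show "(f ol, f ` HHl) = (w, W)" by (simp add: ol_def fl)
qed

lemma M7_frame_exists:
  assumes "(w, W) \<in> M7"
  obtains x y where "x \<in> W" "y \<in> W" "x \<bullet> x = 1" "y \<bullet> y = 1" "w \<bullet> x = 0" "w \<bullet> y = 0" "x \<bullet> y = 0"
proof -
  have W: "subspace W" "dim W = 4" "w \<in> W" using assms by (auto simp: M7_def M1'_iff)
  \<comment> \<open>Fewer than four vectors span a proper subspace of \<open>W\<close>, so a unit
    vector of \<open>W\<close> orthogonal to them remains; this is applied to \<open>{w}\<close> and
    then to \<open>{w, x}\<close>.\<close>
  have ex: "\<exists>x\<in>W. x \<bullet> x = 1 \<and> (\<forall>b\<in>B. b \<bullet> x = 0)" if B: "B \<subseteq> W" "finite B" "card B < 4" for B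
  proof -
    have "dim (span B) < 4" using dim_le_card'[OF B(2)] B(3) by simp
    then have "span B \<noteq> span W" using W by (metis dim_span less_irrefl)
    then have "span B \<subset> span W" using B(1) span_mono by blast
    then obtain x where x: "x \<noteq> 0" "x \<in> span W" "\<And>y. y \<in> span B \<Longrightarrow> orthogonal x y"
      using orthogonal_to_subspace_exists_gen by blast
    then have "x \<in> W" using W(1) by (simp add: span_eq_iff[THEN iffD2])
    then have "sgn x \<in> W" using W(1) by (simp add: sgn_div_norm subspace_scale)
    moreover have "sgn x \<bullet> sgn x = 1" using x(1) by (simp add: dot_square_norm norm_sgn)
    moreover have "b \<bullet> sgn x = 0" if "b \<in> B" for b
      using x(3)[of b] that by (simp add: span_base orthogonal_def sgn_div_norm inner_commute)
    ultimately show ?thesis by blast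
  qed
  obtain x where x: "x \<in> W" "x \<bullet> x = 1" "w \<bullet> x = 0"
    using ex[of "{w}"] W by auto
  have "card {w, x} < 4" using card_insert_le_m1[of 3 "{x}" w] by simp
  then obtain y where "y \<in> W" "y \<bullet> y = 1" "w \<bullet> y = 0" "x \<bullet> y = 0"
    using ex[of "{w, x}"] W x by auto
  with x that show ?thesis by blast
qed

declare qmul.simps [simp del] qcnj.simps [simp del]

section \<open>The group G2 and its transitive action on M7\<close>

lemma carrier_G2 [simp]: "carrier G2 = AutO"
  and mult_G2 [simp]: "f \<otimes>\<^bsub>G2\<^esub> g = f \<circ> g"
  and one_G2 [simp]: "\<one>\<^bsub>G2\<^esub> = id"
  by (simp_all add: G2_def)

lemma AutO_inv_comp: "f \<in> AutO \<Longrightarrow> inv_into UNIV f \<circ> f = id"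
  and AutO_comp_inv: "f \<in> AutO \<Longrightarrow> f \<circ> inv_into UNIV f = id"
  by (meson AutO_inj inj_iff, meson AutO_bij bij_is_surj surj_iff)

lemma group_G2: "group G2"
proof (rule groupI)
  show "\<exists>g\<in>carrier G2. g \<otimes>\<^bsub>G2\<^esub> f = \<one>\<^bsub>G2\<^esub>" if "f \<in> carrier G2" for f
    using that by (intro bexI[of _ "inv_into UNIV f"]) (simp_all add: AutO_inv AutO_inv_comp)
qed (simp_all add: AutO_comp AutO_id comp_assoc)

lemma G2_act_apply: "m \<in> M7 \<Longrightarrow> G2_act f m = (f (fst m), f ` snd m)"
  by (simp add: G2_act_def case_prod_unfold)

lemma G2_act_M7: "f \<in> AutO \<Longrightarrow> m \<in> M7 \<Longrightarrow> G2_act f m \<in> M7"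
  by (cases m) (simp add: G2_act_apply M7_image)

lemma G2_act_comp: "f \<in> AutO \<Longrightarrow> g \<in> AutO \<Longrightarrow> m \<in> M7 \<Longrightarrow> G2_act (f \<circ> g) m = G2_act f (G2_act g m)"
  using G2_act_M7[of g m] by (simp add: G2_act_apply image_comp comp_def)

lemma G2_act_id: "m \<in> M7 \<Longrightarrow> G2_act id m = m"
  by (simp add: G2_act_apply)

lemma G2_act_Bij:
  assumes f: "f \<in> AutO"
  shows "G2_act f \<in> Bij M7"
proof -
  let ?g = "inv_into UNIV f"
  have "G2_act ?g (G2_act f m) = m" "G2_act f (G2_act ?g m) = m" if "m \<in> M7" for m
    using that f by (simp_all add: G2_act_comp[symmetric] AutO_inv AutO_inv_comp AutO_comp_inv G2_act_id)
  then have "bij_betw (G2_act f) M7 M7"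
    using f by (intro bij_betw_byWitness[where f' = "G2_act ?g"]) (auto simp: G2_act_M7 AutO_inv)
  then show ?thesis by (simp add: Bij_def G2_act_def)
qed

lemma transitive_action_G2: "transitive_action G2 M7 G2_act"
proof -
  have "G2_act (f \<circ> g) = compose M7 (G2_act f) (G2_act g)" if "f \<in> AutO" "g \<in> AutO" for f g
  proof
    \<comment> \<open>\<open>BijGroup\<close> consists of extensional maps, so the equality has to
      hold outside \<open>M7\<close> as well, where both sides are \<open>undefined\<close>.\<close>
    show "G2_act (f \<circ> g) m = compose M7 (G2_act f) (G2_act g) m" for m
      using that by (cases "m \<in> M7") (simp_all add: compose_def G2_act_comp, simp add: G2_act_def)
  qed
  then have "G2_act \<in> hom G2 (BijGroup M7)"
    by (simp add: hom_def BijGroup_def G2_act_Bij)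
  then have "group_action G2 M7 G2_act"
    by (intro group_action.intro group_hom.intro group_G2 group_BijGroup group_hom_axioms.intro)
  moreover have base: "\<exists>f\<in>AutO. G2_act f (ol, HHl) = m" if m0: "m \<in> M7" for m
  proof -
    obtain w W where m: "m = (w, W)" by (cases m)
    obtain x y where "x \<in> W" "y \<in> W" "x \<bullet> x = 1" "y \<bullet> y = 1" "w \<bullet> x = 0" "w \<bullet> y = 0" "x \<bullet> y = 0"
      by (rule M7_frame_exists[OF m0[unfolded m]])
    from M7_frame[OF m0[unfolded m] this] show ?thesis
      by (auto simp: m G2_act_apply base_point_M7)
  qed
  have "\<exists>f\<in>AutO. G2_act f m = m'" if m: "m \<in> M7" "m' \<in> M7" for m m'
  proof -
    obtain f g where "f \<in> AutO" "g \<in> AutO" "G2_act f (ol, HHl) = m" "G2_act g (ol, HHl) = m'"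
      using base m by metis
    \<comment> \<open>Any two points are joined through the base point.\<close>
    then have "G2_act (g \<circ> inv_into UNIV f) m = m'"
      by (auto simp: base_point_M7 G2_act_comp[symmetric] AutO_comp AutO_inv AutO_inv_comp comp_assoc)
    with \<open>f \<in> AutO\<close> \<open>g \<in> AutO\<close> show ?thesis by (auto intro: AutO_comp AutO_inv)
  qed
  ultimately show ?thesis
    by (auto intro!: transitive_action.intro transitive_action_axioms.intro)
qed

section \<open>The isotropy group of the base point\<close>

lemma omul_ol: "(0, r) *\<^sub>O ol = (- r, 0)"
  by (cases r) (simp add: omul_rules ol_def q1_def qmul.simps qcnj.simps)

lemma omul_HH: "(p, 0) *\<^sub>O (q, 0) = (p *\<^sub>H q, 0)"
  by (cases p; cases q) (simp add: omul.simps qmul.simps qcnj.simps zero_prod_def)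

text \<open>Right multiplication by \<open>ol\<close> exchanges \<open>HH\<close> and
  \<open>HHl\<close>, and it commutes with any automorphism fixing \<open>ol\<close>. Preserving one
  half therefore amounts to preserving the other; a dimension count upgrades inclusion to
  equality.\<close>

lemma stabilizer_iff:
  assumes f: "f \<in> AutO"
  shows "f ol = ol \<and> f ` HHl = HHl \<longleftrightarrow> f ` HH \<subseteq> HH \<and> f ol = ol"
proof (intro iffI conjI; elim conjE)
  assume l: "f ol = ol" and H: "f ` HH \<subseteq> HH"
  show "f ` HHl = HHl"
  proof (rule subspace_dim_equal)
    show "f ` HHl \<subseteq> HHl"
      using H by (auto simp: HHl_eq AutO_omul[OF f] l)
  qed (use HHl_M1' M1'_image[OF f HHl_M1'] in \<open>auto simp: M1'_iff\<close>)
next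
  assume l: "f ol = ol" and Hl: "f ` HHl = HHl"
  show "f ` HH \<subseteq> HH"
  proof
    fix y assume "y \<in> f ` HH"
    then obtain q where q: "y = f (q, 0)" by (auto simp: HH_def)
    have "(0, q) \<in> HHl" by (simp add: HHl_def)
    then have "f (0, q) \<in> HHl" using Hl by blast
    then obtain r where "f (0, q) = (0, r)" by (auto simp: HHl_def)
    with AutO_omul[OF f, of "(0, q)" ol] l have "f (- q, 0) = (- r, 0)" by (simp add: omul_ol)
    moreover have "f (- q, 0) = - f (q, 0)"
      using linear_neg[OF AutO_linear[OF f], of "(q, 0)"] by simp
    ultimately have "- y = (- r, 0)" by (simp add: q)
    then have "- (- y) = - (- r, 0)" by (simp only:)
    then have "y = (r, 0)" by simp
    then show "y \<in> HH" by (simp add: HH_def)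
  qed
qed

lemma stabilizer_base_point: "stabilizer G2 G2_act (ol, HHl) = H7"
proof -
  have "G2_act f (ol, HHl) = (ol, HHl) \<longleftrightarrow> f ` HH \<subseteq> HH \<and> f ol = ol" if "f \<in> AutO" for f
    using stabilizer_iff[OF that] by (simp add: G2_act_apply base_point_M7)
  then show ?thesis unfolding stabilizer_def H7_def by (auto simp del: split_paired_all)
qed

section \<open>The isotropy group and rotations\<close>

text \<open>In scalar-vector form the quaternion product is expressed by the dot and cross products
  of \<open>real^3\<close>, which brings in the library facts on orthogonal matrices.\<close>

definition qv :: "real \<Rightarrow> real^3 \<Rightarrow> quat" where
  "qv t v = (t, v$1, v$2, v$3)"

fun qvec :: "quat \<Rightarrow> real^3" where
  "qvec (a, b, c, d) = vector [b, c, d]"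

lemma qvec_qv [simp]: "qvec (qv t v) = v"
  by (simp add: qv_def vec_eq_iff forall_3)

lemma fst_qv [simp]: "fst (qv t v) = t"
  by (simp add: qv_def)

lemma qv_collapse [simp]: "qv (fst p) (qvec p) = p"
  by (cases p) (simp add: qv_def)

lemma qv_eq_iff [simp]: "qv t v = qv s w \<longleftrightarrow> t = s \<and> v = w"
  by (metis fst_qv qvec_qv)

lemma qmul_qv: "qv t v *\<^sub>H qv s w = qv (t * s - v \<bullet> w) (t *\<^sub>R w + s *\<^sub>R v + cross3 v w)"
  by (simp add: qv_def qmul.simps cross3_def inner_vec_def sum_3)

lemma qcnj_qv: "qcnj (qv t v) = qv t (- v)"
  by (simp add: qv_def qcnj.simps)

lemma inner_qv: "qv t v \<bullet> qv s w = t * s + v \<bullet> w"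
  by (simp add: qv_def inner_vec_def sum_3)

lemma add_qv: "qv t v + qv s w = qv (t + s) (v + w)"
  and scaleR_qv: "r *\<^sub>R qv t v = qv (r * t) (r *\<^sub>R v)"
  by (simp_all add: qv_def)

lemma linear_qvec: "linear qvec"
proof (rule linearI)
  show "qvec (p + q) = qvec p + qvec q" for p q
    by (metis add_qv qv_collapse qvec_qv)
  show "qvec (r *\<^sub>R p) = r *\<^sub>R qvec p" for r p
    by (metis scaleR_qv qv_collapse qvec_qv)
qed

lemma qv_units: "q1 = qv 1 0" "qi = qv 0 (axis 1 1)" "qj = qv 0 (axis 2 1)" "qk = qv 0 (axis 3 1)"
  by (simp_all add: qv_def q1_def qi_def qj_def qk_def axis_def)

definition qrot :: "real^3^3 \<Rightarrow> quat \<Rightarrow> quat" where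
  "qrot A p = qv (fst p) (A *v qvec p)"

definition orot :: "real^3^3 \<Rightarrow> octo \<Rightarrow> octo" where
  "orot A = map_prod (qrot A) (qrot A)"

lemma qrot_qv [simp]: "qrot A (qv t v) = qv t (A *v v)"
  by (simp add: qrot_def)

lemma linear_qrot: "linear (qrot A)"
  unfolding qrot_def
  by (rule linearI) (simp_all add: linear_add[OF linear_qvec] linear_scale[OF linear_qvec]
      matrix_vector_right_distrib add_qv scaleR_qv matrix_vector_mult_scaleR)

lemma orthogonal_matrix_inner:
  fixes A :: "real^3^3"
  assumes "orthogonal_matrix A"
  shows "(A *v x) \<bullet> (A *v y) = x \<bullet> y"
proof -
  have "orthogonal_transformation ((*v) A)"
    using assms by (simp add: orthogonal_transformation_matrix)
  then show ?thesis by (simp add: orthogonal_transformation_def)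
qed

text \<open>An orthogonal matrix preserves the dot product and multiplies the cross product by its
  determinant, here 1.\<close>

lemma qrot_qmul:
  assumes A: "A \<in> carrier SO3"
  shows "qrot A (p *\<^sub>H q) = qrot A p *\<^sub>H qrot A q"
proof -
  have o: "orthogonal_matrix A" "det A = 1" using A by (simp_all add: SO3_def)
  have "qrot A (qv t v *\<^sub>H qv s w) = qrot A (qv t v) *\<^sub>H qrot A (qv s w)" for t v s w
    using cross_orthogonal_matrix[OF o(1), of v w] o(2)
    by (simp add: qmul_qv orthogonal_matrix_inner[OF o(1)] matrix_vector_right_distrib
        matrix_vector_mult_scaleR)
  from this[of "fst p" "qvec p" "fst q" "qvec q"] show ?thesis by simp
qed

lemma qrot_qcnj: "qrot A (qcnj p) = qcnj (qrot A p)"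
proof -
  have "qrot A (qcnj (qv t v)) = qcnj (qrot A (qv t v))" for t v
    using linear_neg[OF matrix_vector_mul_linear, of A v] by (simp add: qcnj_qv)
  from this[of "fst p" "qvec p"] show ?thesis by simp
qed

lemma orot_comp: "orot A \<circ> orot B = orot (A ** B)"
proof -
  have "qrot A \<circ> qrot B = qrot (A ** B)"
    by (simp add: fun_eq_iff qrot_def matrix_vector_mul_assoc del: split_paired_all)
  then show ?thesis by (simp add: orot_def map_prod_compose[symmetric])
qed

lemma orot_one: "orot (mat 1) = id"
  by (simp add: orot_def qrot_def fun_eq_iff map_prod_def case_prod_unfold)

lemma SO3_transpose:
  assumes "A \<in> carrier SO3"
  shows "transpose A \<in> carrier SO3" "A ** transpose A = mat 1" "transpose A ** A = mat 1"
  using assms by (auto simp: SO3_def orthogonal_matrix_def det_transpose)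

lemma orot_H7:
  assumes A: "A \<in> carrier SO3"
  shows "orot A \<in> H7"
proof -
  have lin: "linear (orot A)"
    unfolding orot_def
    by (rule linearI) (simp_all add: map_prod_def case_prod_unfold linear_add[OF linear_qrot]
        linear_scale[OF linear_qrot])
  moreover have "orot A (x *\<^sub>O y) = orot A x *\<^sub>O orot A y" for x y
  proof -
    obtain p q r s where "x = (p, q)" "y = (r, s)" by (metis surj_pair)
    then show ?thesis
      using A by (simp add: orot_def omul.simps linear_add[OF linear_qrot]
          linear_diff[OF linear_qrot] qrot_qmul qrot_qcnj)
  qed
  moreover have "bij (orot A)"
    using orot_comp orot_one SO3_transpose[OF A] by (metis o_bij)
  ultimately have "orot A \<in> AutO" unfolding AutO_def by blast
  moreover have "orot A ` HH \<subseteq> HH"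
    by (auto simp: orot_def HH_def linear_0[OF linear_qrot])
  moreover have "orot A ol = ol"
    by (simp add: orot_def ol_def linear_0[OF linear_qrot] qv_units)
  ultimately show ?thesis by (simp add: H7_def)
qed

section \<open>Identification of \<open>H7\<close> and of the rotations of \<open>HH0l\<close> with
  \<open>SO3\<close>\<close>

definition vl :: "real^3 \<Rightarrow> octo" where
  "vl v = (0, qv 0 v)"

lemma linear_vl: "linear vl"
  by (rule linearI) (simp_all add: vl_def add_qv scaleR_qv)

lemma inj_vl: "inj vl"
  by (simp add: inj_def vl_def)

lemma inner_vl: "vl v \<bullet> vl w = v \<bullet> w"
  by (simp add: vl_def inner_qv)

lemma orot_vl: "orot A (vl v) = vl (A *v v)"
  by (simp add: orot_def vl_def linear_0[OF linear_qrot])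

lemma HH0l_eq: "HH0l = range vl"
proof -
  have "span {qi, qj, qk} = range (qv 0)"
  proof
    have "subspace (range (qv 0))"
      by (rule linear_subspace_image) (auto intro!: linearI simp: add_qv scaleR_qv)
    then show "span {qi, qj, qk} \<subseteq> range (qv 0)"
      by (rule span_minimal[rotated]) (auto simp: qv_units)
    have "v$1 *\<^sub>R qi + v$2 *\<^sub>R qj + v$3 *\<^sub>R qk \<in> span {qi, qj, qk}" for v :: "real^3"
      by (intro span_add span_scale span_base) simp_all
    moreover have "qv 0 v = v$1 *\<^sub>R qi + v$2 *\<^sub>R qj + v$3 *\<^sub>R qk" for v
      by (simp add: qv_def qi_def qj_def qk_def)
    ultimately show "range (qv 0) \<subseteq> span {qi, qj, qk}" by (simp add: image_subset_iff)
  qed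
  then show ?thesis by (auto simp: HH0l_def vl_def)
qed

text \<open>The matrix with respect to il, jl, kl. It reads values on \<open>HH0l\<close> only, so
  one formula inverts both \<open>orot\<close> and its restricted version.\<close>

definition vl_matrix :: "(octo \<Rightarrow> octo) \<Rightarrow> real^3^3" where
  "vl_matrix g = matrix (\<lambda>v. qvec (snd (g (vl v))))"

lemma vl_matrix_restrict: "vl_matrix (restrict g HH0l) = vl_matrix g"
  by (simp add: vl_matrix_def HH0l_eq)

lemma vl_matrix_orot: "vl_matrix (orot A) = A"
  by (simp add: vl_matrix_def orot_vl) (simp add: vl_def)

text \<open>Since \<open>f\<close> fixes \<open>ol\<close>, it acts on both halves by the same map
  \<open>g\<close> of quaternions. \<open>g\<close> is a multiplicative isometry fixing 1, hence
  preserves imaginary quaternions and is given there by an orthogonal matrix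
  \<open>M\<close>.\<close>

lemma H7_imp_orot:
  assumes f: "f \<in> H7"
  shows "\<exists>A\<in>carrier SO3. f = orot A"
proof -
  have A: "f \<in> AutO" and l: "f ol = ol" and Hl: "f ` HHl = HHl"
    using f stabilizer_iff[of f] by (auto simp: H7_def)
  note lin = AutO_linear[OF A]
  define g where "g q = snd (f (0, q))" for q
  have fg: "f (0, q) = (0, g q)" for q
  proof -
    have "(0, q) \<in> HHl" by (simp add: HHl_def)
    then have "f (0, q) \<in> HHl" using Hl by blast
    then show ?thesis by (auto simp: HHl_def g_def)
  qed
  have fH: "f (q, 0) = (g q, 0)" for q
  proof -
    have "- f (q, 0) = (- g q, 0)"
      using AutO_omul[OF A, of "(0, q)" ol] l linear_neg[OF lin, of "(q, 0)"]
      by (simp add: omul_ol fg)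
    then have "- (- f (q, 0)) = - (- g q, 0)" by (simp only:)
    then show ?thesis by simp
  qed
  have gadd: "g (p + q) = g p + g q" for p q
    using linear_add[OF lin, of "(0, p)" "(0, q)"] by (simp add: fg)
  have gscale: "g (r *\<^sub>R p) = r *\<^sub>R g p" for r p
    using linear_scale[OF lin, of r "(0, p)"] by (simp add: fg)
  have ginner: "g p \<bullet> g q = p \<bullet> q" for p q
    using AutO_inner[OF A, of "(0, p)" "(0, q)"] by (simp add: fg)
  have gmul: "g (p *\<^sub>H q) = g p *\<^sub>H g q" for p q
    using AutO_omul[OF A, of "(p, 0)" "(q, 0)"] by (simp add: fH omul_HH)
  have g1: "g (qv 1 0) = qv 1 0" using l fg[of q1] by (simp add: ol_def qv_units)
  define L where "L v = qvec (g (qv 0 v))" for v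
  have gL: "g (qv 0 v) = qv 0 (L v)" for v
  proof -
    have "fst (g (qv 0 v)) = g (qv 0 v) \<bullet> qv 1 0"
      using inner_qv[of "fst (g (qv 0 v))" "qvec (g (qv 0 v))" 1 0] by simp
    also have "\<dots> = 0" using ginner[of "qv 0 v" "qv 1 0"] by (simp add: g1 inner_qv)
    finally show ?thesis unfolding L_def by (metis qv_collapse)
  qed
  have linL: "linear L"
  proof (rule linearI)
    show "L (v + w) = L v + L w" for v w
      using gadd[of "qv 0 v" "qv 0 w"] by (simp add: gL add_qv)
    show "L (r *\<^sub>R v) = r *\<^sub>R L v" for r v
      using gscale[of r "qv 0 v"] by (simp add: gL scaleR_qv)
  qed
  have Linner: "L v \<bullet> L w = v \<bullet> w" for v w
    using ginner[of "qv 0 v" "qv 0 w"] by (simp add: gL inner_qv)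
  define M where "M = matrix L"
  have Mv: "M *v v = L v" for v unfolding M_def using linL by (simp add: matrix_works)
  have o: "orthogonal_matrix M"
    using linL Linner orthogonal_transformation_matrix[of L]
    by (simp add: M_def orthogonal_transformation_def)
  have geq: "g p = qrot M p" for p
  proof -
    have "p = fst p *\<^sub>R qv 1 0 + qv 0 (qvec p)"
      by (simp add: scaleR_qv add_qv)
    then have "g p = fst p *\<^sub>R g (qv 1 0) + g (qv 0 (qvec p))" by (metis gadd gscale)
    then show ?thesis by (simp add: g1 gL scaleR_qv add_qv qrot_def Mv)
  qed
  \<comment> \<open>One nonzero cross product decides the sign: multiplicativity of \<open>g\<close>
    on \<open>i\<close> and \<open>j\<close> gives factor 1 where orthogonality alone gives
    \<open>det M\<close>.\<close>
  let ?v = "axis 1 1 :: real^3" and ?w = "axis 2 1 :: real^3"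
  have "L (cross3 ?v ?w) = cross3 (L ?v) (L ?w)"
    using gmul[of "qv 0 ?v" "qv 0 ?w"] by (simp add: qmul_qv geq Mv)
  with cross_orthogonal_matrix[OF o, of ?v ?w]
  have "(det M - 1) *\<^sub>R L (cross3 ?v ?w) = 0" by (simp add: Mv scaleR_left_diff_distrib)
  moreover have "L (cross3 ?v ?w) \<noteq> 0"
  proof -
    have "cross3 ?v ?w \<bullet> cross3 ?v ?w = 1" by (simp add: cross3_def axis_def inner_vec_def sum_3)
    then show ?thesis using Linner[of "cross3 ?v ?w" "cross3 ?v ?w"] by auto
  qed
  ultimately have "M \<in> carrier SO3" using o by (simp add: SO3_def)
  moreover have "f = orot M"
  proof
    fix x :: octo
    obtain p q where x: "x = (p, q)" by (metis surj_pair)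
    have "f (p, q) = f (p, 0) + f (0, q)" using linear_add[OF lin, of "(p, 0)" "(0, q)"] by simp
    then show "f x = orot M x" by (simp add: x fH fg geq orot_def)
  qed
  ultimately show ?thesis by blast
qed

lemma H7_eq: "H7 = orot ` carrier SO3"
  using H7_imp_orot orot_H7 by blast

lemma vl_HH0l: "vl v \<in> HH0l"
  by (simp add: HH0l_eq)

lemma range_axis_Basis: "range (\<lambda>j. axis j (1 :: real)) = Basis"
  by (auto simp: Basis_vec_def)

lemma orot_SO_sub:
  assumes A: "A \<in> carrier SO3"
  shows "restrict (orot A) HH0l \<in> carrier (SO_sub HH0l)"
proof -
  have o: "orthogonal_matrix A" "det A = 1" using A by (simp_all add: SO3_def)
  note vl = vl_HH0l
  have "has_det3 HH0l (restrict (orot A) HH0l) 1"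
    unfolding has_det3_def
  proof (intro exI conjI allI)
    \<comment> \<open>In the basis il, jl, kl the matrix of the restricted map is \<open>A\<close>
      itself, so the determinant is immediate.\<close>
    let ?b = "\<lambda>j :: 3. vl (axis j 1)"
    show "inj ?b" by (simp add: inj_def inj_eq[OF inj_vl] axis_eq_axis)
    have b: "range ?b = vl ` Basis" by (simp add: range_axis_Basis[symmetric] image_image)
    show "independent (range ?b)" unfolding b
      by (intro linear_independent_injective_image linear_vl independent_Basis
          inj_on_subset[OF inj_vl]) simp
    show "span (range ?b) = HH0l"
      unfolding b by (simp add: linear_span_image[OF linear_vl] HH0l_eq)
    have "A *v axis j 1 = (\<Sum>i\<in>UNIV. A $ i $ j *\<^sub>R axis i 1)" for j
      using exhaust_3[of j] by (auto simp: vec_eq_iff sum_3 axis_def matrix_vector_mult_def forall_3)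
    then show "restrict (orot A) HH0l (?b j) = (\<Sum>i\<in>UNIV. A $ i $ j *\<^sub>R ?b i)" for j
      using vl by (simp add: orot_vl linear_sum[OF linear_vl] linear_scale[OF linear_vl])
  qed (rule o)
  then show ?thesis
    using vl
    by (auto simp: SO_sub_def HH0l_eq orot_vl oct_n_def inner_vl orthogonal_matrix_inner[OF o(1)]
        linear_add[OF linear_vl, symmetric] linear_scale[OF linear_vl, symmetric]
        matrix_vector_right_distrib matrix_vector_mult_scaleR simp del: split_paired_all)
qed

text \<open>\<open>has_det3\<close> supplies the determinant in some unknown basis. With the
  change-of-basis matrix \<open>B\<close>, whose columns \<beta> span \<open>real^3\<close>, one
  gets \<open>A ** B = B ** M\<close>, and \<open>det B\<close> cancels.\<close>

lemma SO_sub_imp_orot: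
  assumes g: "g \<in> carrier (SO_sub HH0l)"
  shows "\<exists>A\<in>carrier SO3. g = restrict (orot A) HH0l"
proof -
  note vl = vl_HH0l
  have ext: "g \<in> HH0l \<rightarrow>\<^sub>E HH0l"
    and add: "\<And>x y. x \<in> HH0l \<Longrightarrow> y \<in> HH0l \<Longrightarrow> g (x + y) = g x + g y"
    and scale: "\<And>c x. x \<in> HH0l \<Longrightarrow> g (c *\<^sub>R x) = c *\<^sub>R g x"
    and n: "\<And>x. x \<in> HH0l \<Longrightarrow> g x \<bullet> g x = x \<bullet> x"
    and d: "has_det3 HH0l g 1"
    using g unfolding SO_sub_def oct_n_def by (simp_all del: split_paired_all)
  define L where "L v = qvec (snd (g (vl v)))" for v
  have gL: "g (vl v) = vl (L v)" for v
  proof -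
    have "g (vl v) \<in> range vl" using ext vl HH0l_eq by blast
    then show ?thesis by (auto simp: L_def vl_def)
  qed
  have linL: "linear L"
  proof (rule linearI)
    show "L (v + w) = L v + L w" for v w
      using add[OF vl vl, of v w] by (simp add: linear_add[OF linear_vl, symmetric] gL inj_eq[OF inj_vl])
    show "L (r *\<^sub>R v) = r *\<^sub>R L v" for r v
      using scale[OF vl, of r v] by (simp add: linear_scale[OF linear_vl, symmetric] gL inj_eq[OF inj_vl])
  qed
  define A where "A = matrix L"
  have AL: "A *v v = L v" for v unfolding A_def using linL by (simp add: matrix_works)
  have "norm (L v) = norm v" for v
    using n[OF vl, of v] by (simp add: gL inner_vl norm_eq_sqrt_inner)
  then have o: "orthogonal_matrix A"
    using linL orthogonal_transformation_matrix[of L] by (simp add: A_def orthogonal_transformation)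
  obtain b :: "3 \<Rightarrow> octo" and M :: "real^3^3" where b: "span (range b) = HH0l"
    and M: "\<And>j. g (b j) = (\<Sum>i\<in>UNIV. M $ i $ j *\<^sub>R b i)" "det M = 1"
    using d unfolding has_det3_def by blast
  have "\<exists>v. b j = vl v" for j
  proof -
    have "b j \<in> span (range b)" by (simp add: span_base)
    then show ?thesis by (auto simp: b HH0l_eq)
  qed
  then obtain \<beta> where \<beta>: "\<And>j. b j = vl (\<beta> j)" by metis
  define B :: "real^3^3" where "B = (\<chi> i j. \<beta> j $ i)"
  have "vl (A *v \<beta> j) = vl (\<Sum>i\<in>UNIV. M $ i $ j *\<^sub>R \<beta> i)" for j
    using M(1)[of j] by (simp add: \<beta> gL AL linear_sum[OF linear_vl] linear_scale[OF linear_vl])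
  then have A\<beta>: "A *v \<beta> j = (\<Sum>i\<in>UNIV. M $ i $ j *\<^sub>R \<beta> i)" for j
    using inj_vl by (simp add: inj_eq)
  have "(A ** B) $ i $ j = (B ** M) $ i $ j" for i j
    using arg_cong[OF A\<beta>[of j], of "\<lambda>v. v $ i"]
    by (simp add: B_def matrix_matrix_mult_def matrix_vector_mult_def mult.commute)
  then have "A ** B = B ** M" by (simp add: vec_eq_iff)
  then have "det A * det B = det B * det M" by (metis det_mul)
  moreover have "det B \<noteq> 0"
  proof -
    have "vl ` span (range \<beta>) = vl ` UNIV"
      using b by (simp add: linear_span_image[OF linear_vl, symmetric] image_image \<beta> HH0l_eq)
    then have "span (range \<beta>) = UNIV" using inj_vl by (simp add: inj_image_eq_iff)
    moreover have "columns B = range \<beta>" by (auto simp: columns_def column_def B_def)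
    ultimately have "\<exists>C. B ** C = mat 1" by (simp add: matrix_right_invertible_span_columns span_vec_eq)
    then show ?thesis using invertible_det_nz invertible_right_inverse by blast
  qed
  ultimately have "A \<in> carrier SO3" using o M(2) by (simp add: SO3_def)
  moreover have "g x = restrict (orot A) HH0l x" for x
  proof (cases "x \<in> HH0l")
    case True
    then obtain v where "x = vl v" by (auto simp: HH0l_eq)
    then show ?thesis using vl by (simp add: gL orot_vl AL)
  next
    case False
    then show ?thesis using ext PiE_arb by fastforce
  qed
  ultimately show ?thesis by blast
qed

lemma SO_sub_eq: "carrier (SO_sub HH0l) = (\<lambda>A. restrict (orot A) HH0l) ` carrier SO3"
  using SO_sub_imp_orot orot_SO_sub by blast

lemma compose_orot:
  "compose HH0l (restrict (orot A) HH0l) (restrict (orot B) HH0l) = restrict (orot (A ** B)) HH0l"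
proof
  fix x
  show "compose HH0l (restrict (orot A) HH0l) (restrict (orot B) HH0l) x = restrict (orot (A ** B)) HH0l x"
  proof (cases "x \<in> HH0l")
    case True
    then obtain v where "x = vl v" by (auto simp: HH0l_eq)
    then show ?thesis by (simp add: compose_def orot_vl vl_HH0l matrix_vector_mul_assoc)
  qed (simp add: compose_def)
qed

section \<open>The isomorphisms of Lie groups\<close>

lemma vl_axis: "vl (axis 1 1) = (0, qi)" "vl (axis 2 1) = (0, qj)" "vl (axis 3 1) = (0, qk)"
  by (simp_all add: vl_def qv_units)

lemma vl_units_HH0l: "(0, qi) \<in> HH0l" "(0, qj) \<in> HH0l" "(0, qk) \<in> HH0l"
  by (simp_all add: vl_HH0l flip: vl_axis)

text \<open>As \<open>(q l) l = - q\<close>, all coordinates of an element of \<open>H7\<close> are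
  affine in its values on il, jl, kl. This is what makes the inverse of the restriction map
  smooth.\<close>

lemma end_coords_orot:
  "end_coords (orot A) = (o1, - (orot A (0, qi) *\<^sub>O ol), - (orot A (0, qj) *\<^sub>O ol), - (orot A (0, qk) *\<^sub>O ol),
     ol, orot A (0, qi), orot A (0, qj), orot A (0, qk))"
proof -
  have "orot A (q1, 0) = o1" "orot A (0, q1) = ol"
    by (simp_all add: orot_def linear_0[OF linear_qrot] o1_def ol_def qv_units)
  moreover have "orot A (q, 0) = - (orot A (0, q) *\<^sub>O ol)" for q
    by (simp add: orot_def omul_ol linear_0[OF linear_qrot])
  ultimately show ?thesis by (simp add: end_coords_def)
qed

lemma Cinf_map_omul:
  "Cinf_map U f \<Longrightarrow> Cinf_map U g \<Longrightarrow> Cinf_map U (\<lambda>x. f x *\<^sub>O g x)"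
  by (rule Cinf_map_bilinear[OF bounded_bilinear_omul])

lemma restrict_lie_iso:
  "(\<lambda>f. restrict f HH0l) \<in> lie_iso (G2\<lparr>carrier := H7\<rparr>) H7_space (SO_sub HH0l) SO_HH0l_space"
proof -
  have "(\<lambda>f. restrict f HH0l) \<in> hom (G2\<lparr>carrier := H7\<rparr>) (SO_sub HH0l)"
    by (auto simp: hom_def H7_eq orot_SO_sub orot_comp)
      (simp add: SO_sub_def compose_orot)
  moreover have "bij_betw (\<lambda>f. restrict f HH0l) H7 (carrier (SO_sub HH0l))"
    by (rule bij_betw_byWitness[where f' = "\<lambda>g. orot (vl_matrix g)"])
      (auto simp: H7_eq SO_sub_eq vl_matrix_restrict vl_matrix_orot)
  moreover have "diffeomorphism H7_space SO_HH0l_space (\<lambda>f. restrict f HH0l)"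
    unfolding H7_space_def SO_HH0l_space_def
  \<comment> \<open>\<Phi> keeps the last three of the eight coordinates, the values on il, jl, kl;
    \<Psi> rebuilds the others by \<open>end_coords_orot\<close>.\<close>
  proof (rule diffeomorphism_embedded[where G = "\<lambda>g. orot (vl_matrix g)"
        and \<Phi> = "\<lambda>x. snd (snd (snd (snd (snd x))))"
        and \<Psi> = "\<lambda>y. (o1, - (fst y *\<^sub>O ol), - (fst (snd y) *\<^sub>O ol), - (snd (snd y) *\<^sub>O ol),
                   ol, fst y, fst (snd y), snd (snd y))"])
    have neg: "linear (uminus :: octo \<Rightarrow> octo)" by (simp add: linear_iff)
    show "Cinf_map UNIV (\<lambda>x :: octo \<times> octo \<times> octo \<times> octo \<times> octo \<times> octo \<times> octo \<times> octo. snd (snd (snd (snd (snd x)))))"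
      by (intro Cinf_map_snd Cinf_map_id open_UNIV)
    show "Cinf_map UNIV (\<lambda>y. (o1, - (fst y *\<^sub>O ol), - (fst (snd y) *\<^sub>O ol), - (snd (snd y) *\<^sub>O ol),
                   ol, fst y, fst (snd y), snd (snd y)))"
      by (intro Cinf_map_Pair Cinf_map_fst Cinf_map_snd Cinf_map_id Cinf_map_const open_UNIV
          Cinf_map_linear[OF neg] Cinf_map_omul)
    fix f assume "f \<in> H7"
    then obtain A where f: "f = orot A" "A \<in> carrier SO3" by (auto simp: H7_eq)
    then show "restrict f HH0l \<in> carrier (SO_sub HH0l) \<and> orot (vl_matrix (restrict f HH0l)) = f"
      by (simp add: orot_SO_sub vl_matrix_restrict vl_matrix_orot)
    show "(restrict f HH0l (0, qi), restrict f HH0l (0, qj), restrict f HH0l (0, qk)) =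
        snd (snd (snd (snd (snd (end_coords f)))))"
      by (simp add: end_coords_def vl_units_HH0l)
  next
    fix g assume "g \<in> carrier (SO_sub HH0l)"
    then obtain A where g: "g = restrict (orot A) HH0l" "A \<in> carrier SO3" by (auto simp: SO_sub_eq)
    then show "orot (vl_matrix g) \<in> H7 \<and> restrict (orot (vl_matrix g)) HH0l = g"
      by (simp add: orot_H7 vl_matrix_restrict vl_matrix_orot)
    let ?y = "(g (0, qi), g (0, qj), g (0, qk))"
    show "end_coords (orot (vl_matrix g)) = (o1, - (fst ?y *\<^sub>O ol), - (fst (snd ?y) *\<^sub>O ol),
        - (snd (snd ?y) *\<^sub>O ol), ol, fst ?y, fst (snd ?y), snd (snd ?y))"
      by (simp add: g vl_matrix_restrict vl_matrix_orot end_coords_orot vl_units_HH0l)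
  qed
  ultimately show ?thesis by (simp add: lie_iso_def iso_def)
qed

lemma SO_sub_SO3_lie_iso: "vl_matrix \<in> lie_iso (SO_sub HH0l) SO_HH0l_space SO3 SO3_space"
proof -
  let ?r = "\<lambda>A. restrict (orot A) HH0l"
  have "vl_matrix \<in> hom (SO_sub HH0l) SO3"
    unfolding hom_def SO_sub_eq
    by (auto simp: vl_matrix_restrict vl_matrix_orot)
      (simp add: SO_sub_def SO3_def compose_orot vl_matrix_restrict vl_matrix_orot)
  moreover have "bij_betw vl_matrix (carrier (SO_sub HH0l)) (carrier SO3)"
    by (rule bij_betw_byWitness[where f' = ?r])
      (auto simp: SO_sub_eq vl_matrix_restrict vl_matrix_orot)
  moreover have "diffeomorphism SO_HH0l_space SO3_space vl_matrix"
    unfolding SO3_space_def SO_HH0l_space_def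
  \<comment> \<open>The columns of the matrix are the vector parts of the images of il, jl, kl, so
    both coordinate changes are linear.\<close>
  proof (rule diffeomorphism_embedded[where G = ?r
        and \<Phi> = "\<lambda>y. \<chi> i j. qvec (snd (if j = 1 then fst y else if j = 2 then fst (snd y) else snd (snd y))) $ i"
        and \<Psi> = "\<lambda>A. (vl (A *v axis 1 1), vl (A *v axis 2 1), vl (A *v axis 3 1))"])
    show "Cinf_map UNIV (\<lambda>y :: octo \<times> octo \<times> octo.
        \<chi> i j. qvec (snd (if j = 1 then fst y else if j = 2 then fst (snd y) else snd (snd y))) $ i :: real^3^3)"
      by (rule Cinf_map_linear[OF _ Cinf_map_id]; (rule linearI)?)
        (auto simp: vec_eq_iff linear_add[OF linear_qvec] linear_scale[OF linear_qvec])
    have "linear (\<lambda>A :: real^3^3. vl (A *v axis j 1))" for j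
      by (rule linearI) (simp_all add: matrix_vector_mult_add_rdistrib
          linear_add[OF linear_vl] linear_scale[OF linear_vl, symmetric] scaleR_matrix_vector_assoc[symmetric])
    then show "Cinf_map UNIV (\<lambda>A :: real^3^3. (vl (A *v axis 1 1), vl (A *v axis 2 1), vl (A *v axis 3 1)))"
      by (intro Cinf_map_Pair Cinf_map_linear[OF _ Cinf_map_id]) auto
    fix g assume "g \<in> carrier (SO_sub HH0l)"
    then obtain A where g: "g = ?r A" "A \<in> carrier SO3" by (auto simp: SO_sub_eq)
    then show "vl_matrix g \<in> carrier SO3 \<and> ?r (vl_matrix g) = g"
      by (simp add: vl_matrix_restrict vl_matrix_orot)
    show "vl_matrix g = (\<chi> i j. qvec (snd (if j = 1 then fst (g (0, qi), g (0, qj), g (0, qk))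
        else if j = 2 then fst (snd (g (0, qi), g (0, qj), g (0, qk)))
        else snd (snd (g (0, qi), g (0, qj), g (0, qk))))) $ i)"
      by (simp add: vl_matrix_def matrix_def vec_eq_iff forall_3 vl_axis)
  next
    fix A assume A: "A \<in> carrier SO3"
    then show "?r A \<in> carrier (SO_sub HH0l) \<and> vl_matrix (?r A) = A"
      by (simp add: orot_SO_sub vl_matrix_restrict vl_matrix_orot)
    show "(?r A (0, qi), ?r A (0, qj), ?r A (0, qk)) =
        (vl (A *v axis 1 1), vl (A *v axis 2 1), vl (A *v axis 3 1))"
      by (simp add: vl_HH0l orot_vl flip: vl_axis)
  qed
  ultimately show ?thesis by (simp add: lie_iso_def iso_def)
qed

section \<open>The diffeomorphism onto the homogeneous space\<close>

text \<open>This is the fibre condition for the quotient: two automorphisms moving the base point to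
  the same place differ on the right by an element of its stabilizer.\<close>

lemma base_orbit_eq_iff:
  assumes f: "f \<in> AutO" and g: "g \<in> AutO"
  shows "f <#\<^bsub>G2\<^esub> H7 = g <#\<^bsub>G2\<^esub> H7 \<longleftrightarrow> (f ol, f ` HHl) = (g ol, g ` HHl)"
proof -
  have H7: "h \<in> H7 \<longleftrightarrow> h \<in> AutO \<and> (h ol, h ` HHl) = (ol, HHl)" for h
    using stabilizer_iff[of h] by (auto simp: H7_def)
  have coset: "k <#\<^bsub>G2\<^esub> H7 = (\<lambda>h. k \<circ> h) ` H7" for k
    by (auto simp: l_coset_def)
  have sub: "k <#\<^bsub>G2\<^esub> H7 \<subseteq> k' <#\<^bsub>G2\<^esub> H7"
    if k: "k \<in> AutO" "k' \<in> AutO" "(k ol, k ` HHl) = (k' ol, k' ` HHl)" for k k'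
  proof
    fix x assume "x \<in> k <#\<^bsub>G2\<^esub> H7"
    then obtain h where h: "h \<in> H7" "x = k \<circ> h" by (auto simp: coset)
    let ?h = "inv_into UNIV k' \<circ> (k \<circ> h)"
    have hk: "h ol = ol" "h ` HHl = HHl" "k ol = k' ol" "k ` HHl = k' ` HHl"
      using h(1) k(3) by (simp_all add: H7)
    have "?h ol = ol"
      using AutO_inj[OF k(2)] by (simp add: hk)
    moreover have "?h ` HHl = inv_into UNIV k' ` k ` h ` HHl"
      by (simp only: image_comp o_assoc)
    then have "?h ` HHl = HHl"
      using AutO_inj[OF k(2)] by (simp only: hk image_inv_f_f)
    ultimately have "?h \<in> H7" using h(1) k by (simp add: H7 AutO_comp AutO_inv)
    moreover have "x = k' \<circ> ?h"
      using k by (simp add: h(2) AutO_comp_inv flip: comp_assoc)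
    ultimately show "x \<in> k' <#\<^bsub>G2\<^esub> H7" by (auto simp: coset)
  qed
  show ?thesis
  proof
    assume "f <#\<^bsub>G2\<^esub> H7 = g <#\<^bsub>G2\<^esub> H7"
    moreover have "f \<in> f <#\<^bsub>G2\<^esub> H7"
      unfolding coset using AutO_id by (intro image_eqI[of _ _ id]) (auto simp: H7)
    ultimately obtain h where h: "h \<in> H7" "f = g \<circ> h" by (auto simp: coset)
    then have "f ` HHl = g ` h ` HHl" by (simp only: image_comp)
    with h show "(f ol, f ` HHl) = (g ol, g ` HHl)" by (simp add: H7)
  next
    assume eq: "(f ol, f ` HHl) = (g ol, g ` HHl)"
    show "f <#\<^bsub>G2\<^esub> H7 = g <#\<^bsub>G2\<^esub> H7"
      using sub[OF f g eq] sub[OF g f eq[symmetric]] by (rule equalityI)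
  qed
qed

text \<open>An automorphism is an isometry, so the images of l, il, jl, kl form an orthonormal
  basis. The Grassmannian coordinate of the orbit map is thereby quadratic in the coordinates of
  \<open>f\<close>.\<close>

lemma orth_proj_image_HHl:
  assumes f: "f \<in> AutO"
  shows "orth_proj (f ` HHl) v = (v \<bullet> f (0, q1)) *\<^sub>R f (0, q1) + (v \<bullet> f (0, qi)) *\<^sub>R f (0, qi) +
    (v \<bullet> f (0, qj)) *\<^sub>R f (0, qj) + (v \<bullet> f (0, qk)) *\<^sub>R f (0, qk)"
proof (rule orth_proj_eqI)
  note lin = AutO_linear[OF f]
  show sub: "subspace (f ` HHl)" using M1'_image[OF f HHl_M1'] by (simp add: M1'_iff)
  have "f (0, q) \<in> f ` HHl" for q by (simp add: HHl_def)
  then show "(v \<bullet> f (0, q1)) *\<^sub>R f (0, q1) + (v \<bullet> f (0, qi)) *\<^sub>R f (0, qi) +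
    (v \<bullet> f (0, qj)) *\<^sub>R f (0, qj) + (v \<bullet> f (0, qk)) *\<^sub>R f (0, qk) \<in> f ` HHl"
    by (intro subspace_add[OF sub] subspace_scale[OF sub])
  fix z assume "z \<in> f ` HHl"
  then obtain a b c d where "z = f (0, (a, b, c, d))" by (auto simp: HHl_def)
  moreover have "(0, (a, b, c, d)) = a *\<^sub>R (0, q1) + b *\<^sub>R (0, qi) + c *\<^sub>R (0, qj) + d *\<^sub>R (0 :: quat, qk)"
    by (simp add: q1_def qi_def qj_def qk_def)
  ultimately have z: "z = a *\<^sub>R f (0, q1) + b *\<^sub>R f (0, qi) + c *\<^sub>R f (0, qj) + d *\<^sub>R f (0, qk)"
    by (simp only: linear_add[OF lin] linear_scale[OF lin])
  have on: "f (0, p) \<bullet> f (0, q) = p \<bullet> q" for p q by (simp add: AutO_inner[OF f])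
  show "(v - ((v \<bullet> f (0, q1)) *\<^sub>R f (0, q1) + (v \<bullet> f (0, qi)) *\<^sub>R f (0, qi) +
    (v \<bullet> f (0, qj)) *\<^sub>R f (0, qj) + (v \<bullet> f (0, qk)) *\<^sub>R f (0, qk))) \<bullet> z = 0"
    by (simp add: z inner_diff_left inner_add_left inner_add_right on algebra_simps)
      (simp add: q1_def qi_def qj_def qk_def algebra_simps)
qed

text \<open>Evaluation of an operator given by its eight coordinates. It is linear in the
  coordinates and defined on the whole ambient space, as a smooth local formula requires.\<close>

fun end_apply :: "octo \<times> octo \<times> octo \<times> octo \<times> octo \<times> octo \<times> octo \<times> octo \<Rightarrow> octo \<Rightarrow> octo" where
  "end_apply (P1, P2, P3, P4, P5, P6, P7, P8) ((a, b, c, d), (e, f, g, h)) =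
     a *\<^sub>R P1 + b *\<^sub>R P2 + c *\<^sub>R P3 + d *\<^sub>R P4 + e *\<^sub>R P5 + f *\<^sub>R P6 + g *\<^sub>R P7 + h *\<^sub>R P8"

lemma linear_end_apply: "linear (\<lambda>P. end_apply P v)"
  by (cases v rule: octo_cases; intro linearI; clarsimp simp: algebra_simps)

lemma end_apply_end_coords:
  assumes "linear F"
  shows "end_apply (end_coords F) v = F v"
proof -
  obtain a b c d e f g h where v: "v = ((a, b, c, d), (e, f, g, h))" by (rule octo_cases)
  have "v = a *\<^sub>R (q1, 0) + b *\<^sub>R (qi, 0) + c *\<^sub>R (qj, 0) + d *\<^sub>R (qk, 0) +
      e *\<^sub>R (0, q1) + f *\<^sub>R (0, qi) + g *\<^sub>R (0, qj) + h *\<^sub>R (0, qk)"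
    by (simp add: v q1_def qi_def qj_def qk_def zero_prod_def)
  then have "F v = a *\<^sub>R F (q1, 0) + b *\<^sub>R F (qi, 0) + c *\<^sub>R F (qj, 0) + d *\<^sub>R F (qk, 0) +
      e *\<^sub>R F (0, q1) + f *\<^sub>R F (0, qi) + g *\<^sub>R F (0, qj) + h *\<^sub>R F (0, qk)"
    by (simp only: linear_add[OF assms] linear_scale[OF assms])
  then show ?thesis by (simp add: v end_coords_def)
qed

lemma end_coords_triple_map:
  "end_coords (triple_map a b c) = (o1, a, b, a *\<^sub>O b, c, a *\<^sub>O c, b *\<^sub>O c, (a *\<^sub>O b) *\<^sub>O c)"
  unfolding end_coords_def triple_map.simps linear_0[OF linear_oct_h]
  by (simp add: q1_def qi_def qj_def qk_def omul.zero_left)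

lemma smooth_map_base_orbit: "smooth_map G2_space M7_space (\<lambda>f. (f ol, f ` HHl))"
  unfolding G2_space_def M7_space_def
proof (rule smooth_map_embedded)
  show "(f ol, f ` HHl) \<in> M7" if "f \<in> AutO" for f using M7_image[OF that base_point_M7] .
  let ?c5 = "\<lambda>X :: octo \<times> octo \<times> octo \<times> octo \<times> octo \<times> octo \<times> octo \<times> octo. fst (snd (snd (snd (snd X))))"
    and ?c6 = "\<lambda>X :: octo \<times> octo \<times> octo \<times> octo \<times> octo \<times> octo \<times> octo \<times> octo. fst (snd (snd (snd (snd (snd X)))))"
    and ?c7 = "\<lambda>X :: octo \<times> octo \<times> octo \<times> octo \<times> octo \<times> octo \<times> octo \<times> octo. fst (snd (snd (snd (snd (snd (snd X))))))"
    and ?c8 = "\<lambda>X :: octo \<times> octo \<times> octo \<times> octo \<times> octo \<times> octo \<times> octo \<times> octo. snd (snd (snd (snd (snd (snd (snd X))))))"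
  \<comment> \<open>Coordinates 5 to 8 are the images of l, il, jl, kl, so this is the projection
    formula read off from \<open>end_coords f\<close>.\<close>
  let ?P = "\<lambda>X v. (v \<bullet> ?c5 X) *\<^sub>R ?c5 X + (v \<bullet> ?c6 X) *\<^sub>R ?c6 X + (v \<bullet> ?c7 X) *\<^sub>R ?c7 X + (v \<bullet> ?c8 X) *\<^sub>R ?c8 X"
  let ?\<Phi> = "\<lambda>X. (?c5 X, end_coords (?P X))"
  have "Cinf_map UNIV ?\<Phi>"
    unfolding end_coords_def
    by (intro Cinf_map_Pair Cinf_map_add Cinf_map_scaleR Cinf_map_inner Cinf_map_fst Cinf_map_snd
        Cinf_map_id Cinf_map_const open_UNIV)
  moreover have "(case (f ol, f ` HHl) of (w, W) \<Rightarrow> (w, end_coords (orth_proj W))) = ?\<Phi> (end_coords f)"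
    if "f \<in> AutO" for f
  proof -
    have "orth_proj (f ` HHl) = ?P (end_coords f)"
      by (rule ext) (simp add: orth_proj_image_HHl[OF that] end_coords_def)
    then show ?thesis by (simp add: end_coords_def[of f] ol_def)
  qed
  ultimately show "\<exists>N \<Phi>. end_coords f \<in> N \<and> Cinf_map N \<Phi> \<and> (\<forall>f'\<in>AutO. end_coords f' \<in> N \<longrightarrow>
    (case (f' ol, f' ` HHl) of (w, W) \<Rightarrow> (w, end_coords (orth_proj W))) = \<Phi> (end_coords f'))"
    if "f \<in> AutO" for f
    by (intro exI[of _ UNIV] exI[of _ ?\<Phi>]) auto
qed

text \<open>A frame of \<open>W0\<close> is carried to nearby \<open>W\<close> by orthogonal projection and Gram-Schmidt; this
  gives the local sections.\<close>

lemma M7_local_section: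
  assumes m0: "(w0, W0) \<in> M7"
  defines "e \<equiv> \<lambda>(w, W). (w, end_coords (orth_proj W))"
  shows "\<exists>N \<sigma> \<Phi>. e (w0, W0) \<in> N \<and> Cinf_map N \<Phi> \<and>
    (\<forall>m\<in>M7. e m \<in> N \<longrightarrow> \<sigma> m \<in> AutO \<and> (\<sigma> m ol, \<sigma> m ` HHl) = m \<and> end_coords (\<sigma> m) = \<Phi> (e m))"
proof -
  obtain x0 y0 where x0: "x0 \<in> W0" "y0 \<in> W0" "x0 \<bullet> x0 = 1" "y0 \<bullet> y0 = 1"
    "w0 \<bullet> x0 = 0" "w0 \<bullet> y0 = 0" "x0 \<bullet> y0 = 0"
    by (rule M7_frame_exists[OF m0])
  \<comment> \<open>For \<open>X = e (w, W)\<close>, \<open>fst X\<close> is \<open>w\<close> and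
    \<open>snd X\<close> encodes the projection onto \<open>W\<close>; subtracting the
    \<open>w\<close>-component leaves a vector of \<open>W\<close> orthogonal to
    \<open>w\<close>.\<close>
  define u where "u X = end_apply (snd X) x0 - (end_apply (snd X) x0 \<bullet> fst X) *\<^sub>R fst X" for X
  define z where "z X = end_apply (snd X) y0 - (end_apply (snd X) y0 \<bullet> fst X) *\<^sub>R fst X" for X
  \<comment> \<open>This is the Gram-Schmidt vector multiplied by \<open>u X \<bullet> u X\<close>.
    No division occurs, so \<open>v\<close> is smooth everywhere, and \<open>sgn\<close> later
    removes the positive factor.\<close>
  define v where "v X = (u X \<bullet> u X) *\<^sub>R z X - (z X \<bullet> u X) *\<^sub>R u X" for X
  define a where "a X = fst X *\<^sub>O sgn (u X)" for X
  define b where "b X = fst X *\<^sub>O sgn (v X)" for X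
  define N where "N = {X. u X \<noteq> 0} \<inter> {X. v X \<noteq> 0}"
  define \<Phi> where "\<Phi> X = (o1, a X, b X, a X *\<^sub>O b X, fst X, a X *\<^sub>O fst X, b X *\<^sub>O fst X,
    (a X *\<^sub>O b X) *\<^sub>O fst X)" for X
  have u: "Cinf_map UNIV u" and z: "Cinf_map UNIV z"
    unfolding u_def[abs_def] z_def[abs_def]
    by (intro Cinf_map_diff Cinf_map_scaleR Cinf_map_inner Cinf_map_linear[OF linear_end_apply]
        Cinf_map_fst Cinf_map_snd Cinf_map_id open_UNIV)+
  then have v: "Cinf_map UNIV v"
    unfolding v_def[abs_def] by (intro Cinf_map_diff Cinf_map_scaleR Cinf_map_inner)
  have "open N"
    unfolding N_def using Cinf_map_continuous[OF u] Cinf_map_continuous[OF v]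
    by (intro open_Int open_Collect_neq continuous_on_const)
  then have "Cinf_map N u" "Cinf_map N v" "Cinf_map N fst"
    using u v Cinf_map_subset[of UNIV] Cinf_map_fst[OF Cinf_map_id] by auto
  then have "Cinf_map N a" "Cinf_map N b"
    unfolding a_def[abs_def] b_def[abs_def]
    by (intro Cinf_map_omul Cinf_map_sgn; simp add: N_def)+
  then have "Cinf_map N \<Phi>"
    unfolding \<Phi>_def[abs_def] using \<open>open N\<close> \<open>Cinf_map N fst\<close>
    by (intro Cinf_map_Pair Cinf_map_omul Cinf_map_const)
  have sub: "subspace W" "w \<in> W" "w \<bullet> w = 1" if "(w, W) \<in> M7" for w W
    using that by (auto simp: M7_def M1'_iff oct_n_def)
  have app: "end_apply (snd (e (w, W))) = orth_proj W" "fst (e (w, W)) = w" if "(w, W) \<in> M7" for w W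
    using sub(1)[OF that] by (simp_all add: e_def end_apply_end_coords linear_orth_proj fun_eq_iff del: split_paired_all)
  \<comment> \<open>At the centre the construction returns the given frame, so nothing degenerates
    there and \<open>N\<close> is a neighbourhood of that point.\<close>
  have "orth_proj W0 x0 = x0" "orth_proj W0 y0 = y0"
    using sub(1)[OF m0] x0 by (auto intro!: orth_proj_eqI)
  then have "u (e (w0, W0)) = x0" "z (e (w0, W0)) = y0"
    using x0 by (simp_all add: u_def z_def app[OF m0] inner_commute)
  then have "v (e (w0, W0)) = y0" "u (e (w0, W0)) = x0"
    using x0 by (simp_all add: v_def inner_commute)
  then have "e (w0, W0) \<in> N" using x0 by (auto simp: N_def)
  moreover define \<sigma> where "\<sigma> m = triple_map (a (e m)) (b (e m)) (fst m)" for m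
  have "\<sigma> (w, W) \<in> AutO \<and> (\<sigma> (w, W) ol, \<sigma> (w, W) ` HHl) = (w, W) \<and> end_coords (\<sigma> (w, W)) = \<Phi> (e (w, W))"
    if m: "(w, W) \<in> M7" and N: "e (w, W) \<in> N" for w W
  proof -
    let ?X = "e (w, W)"
    note W = sub[OF m]
    have uW: "u ?X \<in> W" "z ?X \<in> W"
      using W by (auto simp: u_def z_def app[OF m] orth_proj intro!: subspace_diff subspace_scale)
    then have vW: "v ?X \<in> W"
      using W by (auto simp: v_def intro!: subspace_diff subspace_scale)
    have wu: "w \<bullet> u ?X = 0" "w \<bullet> z ?X = 0"
      using W by (simp_all add: u_def z_def app[OF m] inner_diff_right inner_commute)
    then have wv: "w \<bullet> v ?X = 0" by (simp add: v_def inner_diff_right)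
    have uv: "u ?X \<bullet> v ?X = 0" by (simp add: v_def inner_diff_right inner_commute)
    have nz: "u ?X \<noteq> 0" "v ?X \<noteq> 0" using N by (auto simp: N_def)
    have \<sigma>: "\<sigma> (w, W) = triple_map (w *\<^sub>O sgn (u ?X)) (w *\<^sub>O sgn (v ?X)) w"
      by (simp add: \<sigma>_def a_def b_def app[OF m])
    have "sgn (u ?X) \<in> W" "sgn (v ?X) \<in> W"
      using uW vW W by (simp_all add: sgn_div_norm subspace_scale)
    moreover have "sgn (u ?X) \<bullet> sgn (u ?X) = 1" "sgn (v ?X) \<bullet> sgn (v ?X) = 1"
      using nz by (simp_all add: dot_square_norm norm_sgn)
    moreover have "w \<bullet> sgn (u ?X) = 0" "w \<bullet> sgn (v ?X) = 0" "sgn (u ?X) \<bullet> sgn (v ?X) = 0"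
      using wu wv uv by (simp_all add: sgn_div_norm)
    ultimately have "\<sigma> (w, W) \<in> AutO" "(\<sigma> (w, W) ol, \<sigma> (w, W) ` HHl) = (w, W)"
      unfolding \<sigma> by (rule M7_frame[OF m])+
    moreover have "end_coords (\<sigma> (w, W)) = \<Phi> ?X"
      by (simp add: \<sigma>_def end_coords_triple_map \<Phi>_def app[OF m])
    ultimately show ?thesis by blast
  qed
  ultimately show ?thesis
    using \<open>Cinf_map N \<Phi>\<close> by (intro exI[of _ N] exI[of _ \<sigma>] exI[of _ \<Phi>]) (simp del: split_paired_all add: Ball_def split_paired_All)
qed

lemma diffeomorphic_M7: "diffeomorphic M7_space G2_mod_H7_space"
  unfolding M7_space_def G2_mod_H7_space_def G2_space_def
proof (rule diffeomorphic_quotient[where q = "\<lambda>f. (f ol, f ` HHl)"])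
  show "smooth_map (embedded_space AutO end_coords)
     (embedded_space M7 (\<lambda>(w, W). (w, end_coords (orth_proj W)))) (\<lambda>f. (f ol, f ` HHl))"
    using smooth_map_base_orbit unfolding G2_space_def M7_space_def .
  show "f <#\<^bsub>G2\<^esub> H7 = g <#\<^bsub>G2\<^esub> H7 \<longleftrightarrow> (f ol, f ` HHl) = (g ol, g ` HHl)" if "f \<in> AutO" "g \<in> AutO" for f g
    using base_orbit_eq_iff[OF that] .
  fix m assume "m \<in> M7"
  moreover obtain w W where m: "m = (w, W)" by (cases m)
  ultimately show "\<exists>N \<sigma> \<Phi>. (case m of (w, W) \<Rightarrow> (w, end_coords (orth_proj W))) \<in> N \<and> Cinf_map N \<Phi> \<and>
      (\<forall>m'\<in>M7. (case m' of (w, W) \<Rightarrow> (w, end_coords (orth_proj W))) \<in> N \<longrightarrow>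
        \<sigma> m' \<in> AutO \<and> (\<sigma> m' ol, \<sigma> m' ` HHl) = m' \<and>
        end_coords (\<sigma> m') = \<Phi> (case m' of (w, W) \<Rightarrow> (w, end_coords (orth_proj W))))"
    using M7_local_section[of w W] unfolding m by blast
qed

theorem mainTheorem6:
  shows "transitive_action G2 M7 G2_act \<and>
    (ol, HHl) \<in> M7 \<and>
    stabilizer G2 G2_act (ol, HHl) = H7 \<and>
    (\<lambda>f. restrict f HH0l) \<in> lie_iso (G2\<lparr>carrier := H7\<rparr>) H7_space (SO_sub HH0l) SO_HH0l_space \<and>
    lie_iso (SO_sub HH0l) SO_HH0l_space SO3 SO3_space \<noteq> {} \<and>
    diffeomorphic M7_space G2_mod_H7_space"
  using transitive_action_G2 base_point_M7 stabilizer_base_point restrict_lie_iso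
    SO_sub_SO3_lie_iso diffeomorphic_M7 by blast

end
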